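(* As $n\to\infty$, $$\mathbb P\{B_n\text{ prime}\}=\sum_{d\le n,\ P^+(d)\le\sqrt n}\frac{\mu(d)}{d}\,\Theta(d,n)+\mathcal O\Big(\frac{\log^{5/2}n}{n}\Big).$$ Further, $$\mathbb P\{B_n\text{ prime}\}=\sqrt{\frac{2}{\pi n}}\sum_{k\in\mathbb Z}\Big(\sum_{d\le n,\ P^+(d)\le\sqrt n}\mu(d)\,e^{-\frac{(2kd-n)^2}{2n}}\Big)+\mathcal O\Big(\frac{\log^{5/2}n}{n}\Big).$$
   Context: $B_n=\sum_{k=1}^n\beta_k$ where $\beta_1,\beta_2,\dots$ are i.i.d. with $\mathbb P\{\beta_i=0\}=\mathbb P\{\beta_i=1\}=1/2$. $\mu$ is the Möbius function; $P^+(d)$ is the largest prime divisor of $d$, with $P^+(1)=1$; $d$ ranges over positive integers. For integers $d,n\ge1$, $$\Theta(d,n)=\sum_{\ell\in\mathbb Z}e^{in\pi\frac{\ell}{d}-\frac{n\pi^2\ell^2}{2d^2}}.$$ *)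

theory Defs
  imports
    "HOL-Probability.Probability"
    "HOL-Number_Theory.Number_Theory"
    "HOL-Computational_Algebra.Squarefree"
    "HOL-Library.Landau_Symbols"
begin

definition moebius_mu :: "nat \<Rightarrow> int" where
  "moebius_mu d = (if squarefree d then (-1) ^ card (prime_factors d) else 0)"

text \<open>For \<open>d = 1\<close> the inserted \<open>1\<close> gives the convention that the largest prime divisor of \<open>1\<close>
  is \<open>1\<close>; for \<open>d \<ge> 2\<close> it does not affect the maximum.\<close>
definition largest_prime_factor :: "nat \<Rightarrow> nat" where
  "largest_prime_factor d = Max (insert 1 (prime_factors d))"

definition sieve_divisors :: "nat \<Rightarrow> nat set" where
  "sieve_divisors n =
     {d. 1 \<le> d \<and> d \<le> n \<and> real (largest_prime_factor d) \<le> sqrt (real n)}"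

text \<open>For \<open>d, n \<ge> 1\<close> the family is absolutely summable (its moduli are Gaussian in \<open>l\<close>), so the
  unordered sum is the sum of the two-sided series.\<close>
definition Theta :: "nat \<Rightarrow> nat \<Rightarrow> complex" where
  "Theta d n = (\<Sum>\<^sub>\<infinity>l\<in>(UNIV :: int set).
     exp (\<i> * of_nat n * of_real pi * (of_int l / of_nat d)
          - of_nat n * (of_real pi)\<^sup>2 * (of_int l)\<^sup>2 / (2 * (of_nat d)\<^sup>2)))"

end

theory Submission
  imports Defs "HOL-Real_Asymp.Real_Asymp"
begin

text \<open>
  Write \<open>b(j)\<close> for the binomial weight of \<open>B_n = j\<close> and \<open>g(j)\<close> for its Gaussian approximation.
  Fourier inversion on both sides reduces \<open>\<bar>b(j) - g(j)\<bar>\<close> to the integral of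
  \<open>\<bar>cos u ^ n - exp (-n u^2 / 2)\<bar>\<close>, which is \<open>O(n powr (-3/2))\<close> uniformly in \<open>j\<close>; with the Chernoff
  bound for the tails, the \<open>l1\<close> distance of \<open>b\<close> and \<open>g\<close> is \<open>O(sqrt (ln n) / n)\<close>.

  A termwise comparison over \<open>d\<close> would lose a factor \<open>n\<close>. Instead, the second
  sum of the theorem is rearranged as \<open>\<Sum>j. g(j) w(j)\<close>, where \<open>w(j)\<close> sums \<open>\<mu>(d)\<close> over the sieving
  divisors \<open>d\<close> of \<open>j\<close>. For \<open>sqrt n < j \<le> n\<close> the weight \<open>w(j)\<close> is the indicator of the primes, so only
  the \<open>l1\<close> distance and exponentially small terms enter the error.

  The two sums of the theorem are equal by the theta transformation formula. As in Polya's
  proof, it is the limit \<open>T \<rightarrow> \<infinity>\<close> of the discrete Fourier expansion of the probability that a binomial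
  variable with \<open>T^2 n\<close> trials lies in a residue class modulo \<open>T d\<close>.
\<close>

section \<open>Local limit theorem for the symmetric binomial distribution\<close>

text \<open>The argument ranges over all integers, with value 0 outside \<open>0..n\<close>, so that
  Pascal's rule \<open>binomial_weight_Suc\<close> needs no boundary cases.\<close>

definition binomial_weight :: "nat \<Rightarrow> int \<Rightarrow> real" where
  "binomial_weight n j = (if j < 0 then 0 else real (n choose nat j) / 2 ^ n)"

text \<open>The density at \<open>j\<close> of the normal law with mean \<open>n/2\<close> and
  variance \<open>n/4\<close>.\<close>

definition gaussian_weight :: "nat \<Rightarrow> int \<Rightarrow> real" where
  "gaussian_weight n j =
     sqrt (2 / (pi * real n)) * exp (- ((2 * real_of_int j - real n)\<^sup>2 / (2 * real n)))"

lemma binomial_weight_0: "binomial_weight 0 j = (if j = 0 then 1 else 0)"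
  by (auto simp: binomial_weight_def)

lemma binomial_weight_Suc:
  "binomial_weight (Suc n) j = (binomial_weight n j + binomial_weight n (j - 1)) / 2"
proof (cases "j \<le> 0")
  case True
  then show ?thesis by (cases "j = 0") (auto simp: binomial_weight_def)
next
  case False
  then obtain k where "j = int (Suc k)"
    by (metis Suc_pred' nat_0_less_mult_iff nonneg_int_cases not_less of_nat_0_less_iff order_less_imp_le)
  then show ?thesis
    by (simp add: binomial_weight_def field_simps nat_add_distrib)
qed

lemma binomial_weight_nonneg: "binomial_weight n j \<ge> 0"
  by (simp add: binomial_weight_def)

lemma binomial_weight_eq_0: "j < 0 \<or> int n < j \<Longrightarrow> binomial_weight n j = 0"
  by (auto simp: binomial_weight_def)

text \<open>Fourier inversion: \<open>cos u ^ n\<close> is the characteristic function of the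
  centred variable \<open>2 B_n - n\<close>. The induction works because Pascal's rule matches the
  product formula for \<open>cos x * cos u\<close>.\<close>

lemma binomial_weight_has_integral:
  "has_bochner_integral lborel
     (\<lambda>u. indicator {-(pi/2)..pi/2} u * (cos u ^ n * cos (real_of_int (int n - 2 * j) * u)))
     (pi * binomial_weight n j)"
proof (induction n arbitrary: j)
  case 0
  \<comment> \<open>Without a power of \<open>cos u\<close> the antiderivative is explicit; for
    nonzero \<open>j\<close> both boundary values contain \<open>sin (pi * j)\<close> and
    vanish.\<close>
  let ?F = "\<lambda>u. if j = 0 then u else sin (2 * real_of_int j * u) / (2 * real_of_int j)"
  have "has_bochner_integral lborel (\<lambda>u. cos (2 * real_of_int j * u) * indicator {-(pi/2)..pi/2} u)
          (?F (pi/2) - ?F (-(pi/2)))"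
    by (cases "j = 0"; intro has_bochner_integral_FTC_Icc_real)
       (auto intro!: derivative_eq_intros continuous_intros)
  moreover have "?F (pi/2) - ?F (-(pi/2)) = pi * binomial_weight 0 j"
    by (auto simp: binomial_weight_0 sin_zero_iff_int2)
  ultimately show ?case by (simp add: mult.commute)
next
  case (Suc n)
  let ?I = "\<lambda>n j u. indicator {-(pi/2)..pi/2} u * (cos u ^ n * cos (real_of_int (int n - 2 * j) * u)) :: real"
  have "has_bochner_integral lborel (\<lambda>u. (?I n j u + ?I n (j - 1) u) / 2)
          ((pi * binomial_weight n j + pi * binomial_weight n (j - 1)) / 2)"
    by (intro has_bochner_integral_divide has_bochner_integral_add Suc)
  moreover have "(?I n j u + ?I n (j - 1) u) / 2 = ?I (Suc n) j u" for u
  proof -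
    define x where "x = real_of_int (int (Suc n) - 2 * j) * u"
    have 1: "real_of_int (int n - 2 * j) * u = x - u" and 2: "real_of_int (int n - 2 * (j - 1)) * u = x + u"
      by (auto simp: x_def algebra_simps)
    show ?thesis
      unfolding 1 2 x_def[symmetric] by (simp add: cos_add cos_diff algebra_simps)
  qed
  ultimately show ?case
    by (simp add: binomial_weight_Suc algebra_simps add_divide_distrib)
qed

text \<open>This is the characteristic function of the standard normal law after rescaling by
  \<open>sqrt n\<close>. The cosine factor agrees with the binomial case, so the two integrands can
  be subtracted pointwise.\<close>

lemma gaussian_weight_has_integral:
  assumes "n > 0"
  shows "has_bochner_integral lborel
     (\<lambda>u. exp (- (real n * u\<^sup>2 / 2)) * cos (real_of_int (int n - 2 * j) * u))
     (pi * gaussian_weight n j)"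
proof -
  have *: "has_bochner_integral lborel (\<lambda>x. std_normal_density x * cos (t * x)) (exp (- (t\<^sup>2 / 2)))" for t
  proof -
    have int: "integrable lborel (\<lambda>x. std_normal_density x *\<^sub>R iexp (t * x))"
      by (rule Bochner_Integration.integrable_bound[OF integrable_normal_density[of 1 0]])
         (auto simp: norm_mult)
    have "char std_normal_distribution t = (LINT x|lborel. std_normal_density x *\<^sub>R iexp (t * x))"
      unfolding char_def by (subst integral_density) (auto simp: normal_density_nonneg)
    then have "has_bochner_integral lborel (\<lambda>x. std_normal_density x *\<^sub>R iexp (t * x))
        (complex_of_real (exp (- (t^2) / 2)))"
      using int by (simp add: has_bochner_integral_iff char_std_normal_distribution)
    from has_bochner_integral_Re[OF this] show ?thesis
      by (simp add: Re_exp)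
  qed
  define s where "s = sqrt (real n)"
  have s: "s > 0" "s\<^sup>2 = real n" using assms by (auto simp: s_def)
  define m where "m = real_of_int (int n - 2 * j)"
  have "has_bochner_integral lborel (\<lambda>x. std_normal_density (0 + s * x) * cos (m / s * (0 + s * x)))
      (exp (- ((m / s)\<^sup>2 / 2)) /\<^sub>R \<bar>s\<bar>)"
    using s lborel_has_bochner_integral_real_affine_iff[of s "\<lambda>x. std_normal_density x * cos (m / s * x)" _ 0] *[of "m/s"]
    by simp
  from has_bochner_integral_mult_right[of "sqrt (2 * pi)", OF this]
  have "has_bochner_integral lborel (\<lambda>x. exp (- (real n * x\<^sup>2 / 2)) * cos (m * x))
      (sqrt (2 * pi) * (exp (- ((m / s)\<^sup>2 / 2)) / s))"
    using s by (simp add: std_normal_density_def power_mult_distrib field_simps)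
  moreover have "sqrt (2 * pi) / s * exp (- ((m / s)\<^sup>2 / 2)) = pi * gaussian_weight n j"
  proof -
    have "sqrt (2 * pi) = sqrt (pi\<^sup>2 * (2 / pi))"
      by (simp add: power2_eq_square)
    also have "\<dots> = pi * sqrt (2 / pi)"
      by (subst real_sqrt_mult) simp
    finally have "sqrt (2 * pi) / s = pi * (sqrt (2 / pi) / s)" by simp
    also have "sqrt (2 / pi) / s = sqrt (2 / (pi * real n))"
      by (simp add: s_def real_sqrt_divide real_sqrt_mult)
    finally have "sqrt (2 * pi) / s = pi * sqrt (2 / (pi * real n))" .
    moreover have "(m / s)\<^sup>2 / 2 = (2 * real_of_int j - real n)\<^sup>2 / (2 * real n)"
      using s by (simp add: m_def power_divide power2_commute)
    ultimately show ?thesis by (simp add: gaussian_weight_def)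
  qed
  ultimately show ?thesis by (simp add: m_def)
qed

section \<open>Pointwise comparison of the integrands\<close>

text \<open>The quotient \<open>exp (y^2 / 2) * cos y\<close> decreases on \<open>[0, pi/2]\<close>,
  since its derivative has the sign of \<open>y * cos y - sin y\<close>.\<close>

lemma cos_le_exp:
  fixes x :: real
  assumes "\<bar>x\<bar> \<le> pi / 2"
  shows "cos x \<le> exp (- (x\<^sup>2 / 2))"
proof -
  define y where "y = \<bar>x\<bar>"
  have y: "0 \<le> y" "y \<le> pi / 2" using assms by (auto simp: y_def)
  have sc: "t * cos t \<le> sin t" if "0 \<le> t" "t \<le> pi / 2" for t :: real
  proof -
    have "sin 0 - 0 * cos 0 \<le> sin t - t * cos t"
    proof (rule DERIV_nonneg_imp_nondecreasing[OF that(1)])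
      fix s assume "0 \<le> s" "s \<le> t"
      then have "((\<lambda>s. sin s - s * cos s) has_real_derivative s * sin s) (at s)" "0 \<le> s * sin s"
        using that by (auto intro!: derivative_eq_intros mult_nonneg_nonneg sin_ge_zero)
      then show "\<exists>d. ((\<lambda>s. sin s - s * cos s) has_real_derivative d) (at s) \<and> 0 \<le> d" by blast
    qed
    then show ?thesis by simp
  qed
  have "exp (y\<^sup>2 / 2) * cos y \<le> exp (0\<^sup>2 / 2) * cos 0"
  proof (rule DERIV_nonpos_imp_nonincreasing[OF y(1)])
    fix s assume "0 \<le> s" "s \<le> y"
    then have "((\<lambda>s. exp (s\<^sup>2 / 2) * cos s) has_real_derivative exp (s\<^sup>2 / 2) * (s * cos s - sin s)) (at s)"
      "exp (s\<^sup>2 / 2) * (s * cos s - sin s) \<le> 0"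
      using y sc[of s] by (auto intro!: derivative_eq_intros simp: mult_le_0_iff algebra_simps)
    then show "\<exists>d. ((\<lambda>s. exp (s\<^sup>2 / 2) * cos s) has_real_derivative d) (at s) \<and> d \<le> 0" by blast
  qed
  then show ?thesis by (simp add: exp_minus field_simps y_def)
qed

text \<open>The same monotonicity argument with \<open>sinh t \<le> t * cosh t\<close>; it feeds the
  Chernoff bound.\<close>

lemma cosh_le_exp:
  fixes x :: real
  shows "cosh x \<le> exp (x\<^sup>2 / 2)"
proof -
  define y where "y = \<bar>x\<bar>"
  have y: "0 \<le> y" by (auto simp: y_def)
  have sc: "sinh t \<le> t * cosh t" if "0 \<le> t" for t :: real
  proof -
    have "0 * cosh 0 - sinh 0 \<le> t * cosh t - sinh t"
    proof (rule DERIV_nonneg_imp_nondecreasing[OF that])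
      fix s assume "0 \<le> s" "s \<le> t"
      then have "((\<lambda>s. s * cosh s - sinh s) has_real_derivative s * sinh s) (at s)" "0 \<le> s * sinh s"
        by (auto intro!: derivative_eq_intros mult_nonneg_nonneg)
      then show "\<exists>d. ((\<lambda>s. s * cosh s - sinh s) has_real_derivative d) (at s) \<and> 0 \<le> d" by blast
    qed
    then show ?thesis by simp
  qed
  have "exp (- (y\<^sup>2 / 2)) * cosh y \<le> exp (- (0\<^sup>2 / 2)) * cosh 0"
  proof (rule DERIV_nonpos_imp_nonincreasing[OF y])
    fix s assume "0 \<le> s" "s \<le> y"
    then have "((\<lambda>s. exp (- (s\<^sup>2 / 2)) * cosh s) has_real_derivative exp (- (s\<^sup>2 / 2)) * (sinh s - s * cosh s)) (at s)"
      "exp (- (s\<^sup>2 / 2)) * (sinh s - s * cosh s) \<le> 0"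
      using sc[of s] by (auto intro!: derivative_eq_intros simp: mult_le_0_iff algebra_simps)
    then show "\<exists>d. ((\<lambda>s. exp (- (s\<^sup>2 / 2)) * cosh s) has_real_derivative d) (at s) \<and> d \<le> 0" by blast
  qed
  then show ?thesis by (simp add: exp_minus field_simps y_def)
qed

lemma exp_minus_le_quadratic:
  fixes y :: real
  assumes "y \<ge> 0"
  shows "exp (- y) \<le> 1 - y + y\<^sup>2 / 2"
proof -
  have "(1 - 0 + 0\<^sup>2 / 2) - exp (- 0) \<le> (1 - y + y\<^sup>2 / 2) - exp (- y)"
  proof (rule DERIV_nonneg_imp_nondecreasing[OF assms])
    fix s :: real assume "0 \<le> s"
    have "((\<lambda>s. (1 - s + s\<^sup>2 / 2) - exp (- s)) has_real_derivative (exp (- s) - (1 + - s))) (at s)"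
      by (auto intro!: derivative_eq_intros)
    moreover have "0 \<le> exp (- s) - (1 + - s)" using exp_ge_add_one_self[of "-s"] by linarith
    ultimately show "\<exists>d. ((\<lambda>s. (1 - s + s\<^sup>2 / 2) - exp (- s)) has_real_derivative d) (at s) \<and> 0 \<le> d" by blast
  qed
  then show ?thesis by simp
qed

lemma cos_ge_quadratic: "1 - x\<^sup>2 / 2 \<le> cos (x::real)"
proof -
  have "(sin (x / 2))\<^sup>2 \<le> (x / 2)\<^sup>2"
    using abs_sin_x_le_abs_x[of "x/2"] unfolding abs_le_square_iff .
  moreover have "cos x = 1 - 2 * (sin (x / 2))\<^sup>2"
    using cos_double_sin[of "x/2"] by simp
  ultimately show ?thesis by (simp add: power_divide)
qed

lemma power_diff_le:
  fixes a b :: real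
  assumes "0 \<le> a" "a \<le> b"
  shows "b ^ Suc n - a ^ Suc n \<le> real (Suc n) * (b - a) * b ^ n"
proof -
  have "(\<Sum>p<Suc n. b ^ p * a ^ (n - p)) \<le> (\<Sum>p<Suc n. b ^ n)"
  proof (rule sum_mono)
    fix p assume "p \<in> {..<Suc n}"
    then have "b ^ n = b ^ p * b ^ (n - p)" by (simp flip: power_add)
    then show "b ^ p * a ^ (n - p) \<le> b ^ n"
      using assms by (auto intro!: mult_left_mono power_mono)
  qed
  then have "(b - a) * (\<Sum>p<Suc n. b ^ p * a ^ (n - p)) \<le> (b - a) * (real (Suc n) * b ^ n)"
    using assms by (intro mult_left_mono) auto
  then show ?thesis
    by (simp only: diff_power_eq_sum mult_ac)
qed

text \<open>Near 0 the functions \<open>cos u\<close> and \<open>exp (- u^2 / 2)\<close> differ only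
  at order \<open>u^4\<close>, and \<open>power_diff_le\<close> carries this to the powers. The
  majorant is integrable on the whole line, so the cut-off at \<open>pi/2\<close> is handled by the
  same bound.\<close>

lemma cos_power_approx:
  assumes n: "n \<ge> 2"
  shows "\<bar>indicator {-(pi/2)..pi/2} u * cos u ^ n - exp (- (real n * u\<^sup>2 / 2))\<bar>
           \<le> real n * u ^ 4 * exp (- (real n * u\<^sup>2 / 4))"
proof (cases "\<bar>u\<bar> \<le> pi / 2")
  case True
  define b where "b = exp (- (u\<^sup>2 / 2))"
  have b: "0 < b" "cos u \<le> b" "0 \<le> cos u"
    using cos_le_exp[OF True] True by (auto simp: b_def intro!: cos_ge_zero)
  have bn: "exp (- (real n * u\<^sup>2 / 2)) = b ^ n"
    by (simp add: b_def flip: exp_of_nat_mult)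
  obtain m where m: "n = Suc m" using n by (cases n) auto
  \<comment> \<open>With \<open>y = u^2 / 2\<close>, the upper bound for \<open>exp (- y)\<close>
    and the lower bound for \<open>cos u\<close> agree up to \<open>u^4 / 8\<close>.\<close>
  have "b - cos u \<le> u ^ 4 / 8"
    using exp_minus_le_quadratic[of "u\<^sup>2/2"] cos_ge_quadratic[of u]
    by (simp add: b_def power_divide)
  \<comment> \<open>Only \<open>n - 1\<close> factors are left; \<open>n \<ge> 2\<close> gives
    \<open>n - 1 \<ge> n / 2\<close>, which turns the 2 in the exponent into a 4.\<close>
  moreover have "b ^ m \<le> exp (- (real n * u\<^sup>2 / 4))"
  proof -
    have "real n * u\<^sup>2 / 4 \<le> real m * u\<^sup>2 / 2"
      using n mult_right_mono[of "real n" "2 * real m" "u\<^sup>2"] by (simp add: m)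
    then show ?thesis by (simp add: b_def flip: exp_of_nat_mult)
  qed
  ultimately have "real n * (b - cos u) * b ^ m \<le> real n * (u ^ 4 / 8) * exp (- (real n * u\<^sup>2 / 4))"
    using b by (intro mult_mono mult_left_mono mult_nonneg_nonneg) auto
  also have "\<dots> \<le> real n * u ^ 4 * exp (- (real n * u\<^sup>2 / 4))"
    by (intro mult_right_mono mult_left_mono) auto
  finally have "b ^ n - cos u ^ n \<le> real n * u ^ 4 * exp (- (real n * u\<^sup>2 / 4))"
    using power_diff_le[OF b(3) b(2), of m] unfolding m by (rule order_trans[rotated])
  moreover have "cos u ^ n \<le> b ^ n" using b by (intro power_mono)
  moreover have "indicator {-(pi/2)..pi/2} u = (1::real)" using True by (auto simp: indicator_def)
  ultimately show ?thesis by (simp add: bn)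
next
  case False
  \<comment> \<open>Outside the window only the exponential remains, and there
    \<open>n * u^4 \<ge> 1\<close>.\<close>
  then have u: "1 \<le> \<bar>u\<bar>" using pi_gt3 by linarith
  then have "1 \<le> u ^ 4" by (metis one_le_power power_even_abs_numeral even_numeral)
  then have "1 * 1 \<le> real n * u ^ 4" using n by (intro mult_mono) auto
  moreover have "exp (- (real n * u\<^sup>2 / 2)) \<le> exp (- (real n * u\<^sup>2 / 4))"
    by (auto intro!: mult_nonneg_nonneg)
  ultimately have "1 * exp (- (real n * u\<^sup>2 / 2)) \<le> real n * u ^ 4 * exp (- (real n * u\<^sup>2 / 4))"
    by (intro mult_mono) auto
  then show ?thesis using False by (auto simp: indicator_def)
qed

text \<open>Up to normalisation this is the fourth moment, \<open>12 / n^2\<close>, of the centred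
  normal law with variance \<open>2 / n\<close>.\<close>

lemma gaussian_fourth_moment:
  assumes "n > 0"
  shows "has_bochner_integral lborel (\<lambda>u. real n * u ^ 4 * exp (- (real n * u\<^sup>2 / 4)))
           (24 * sqrt pi / (real n * sqrt (real n)))"
proof -
  define s where "s = sqrt (2 / real n)"
  have s: "s > 0" "s\<^sup>2 = 2 / real n" using assms by (auto simp: s_def)
  have "has_bochner_integral lborel (\<lambda>x. normal_density 0 s x * (x - 0) ^ (2 * 2)) (fact (2 * 2) / ((2 / s\<^sup>2) ^ 2 * fact 2))"
    by (rule normal_moment_even[OF s(1)])
  from has_bochner_integral_mult_right[of "real n * sqrt (4 * pi / real n)", OF this]
  have "has_bochner_integral lborel (\<lambda>x. real n * x ^ 4 * exp (- (real n * x\<^sup>2 / 4)))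
     (real n * sqrt (4 * pi / real n) * (12 / (real n)\<^sup>2))"
    using assms by (simp add: normal_density_def s fact_numeral field_simps)
  moreover have "real n * sqrt (4 * pi / real n) * (12 / (real n)\<^sup>2) = 24 * sqrt pi / (real n * sqrt (real n))"
    using assms by (simp add: real_sqrt_divide real_sqrt_mult power2_eq_square)
  ultimately show ?thesis by simp
qed

text \<open>The two Fourier integrals share a cosine factor bounded by 1, so the majorant of
  \<open>cos_power_approx\<close> gives a bound uniform in \<open>j\<close>. The fourth-order
  agreement of the integrands gains a factor \<open>1/n\<close> over the size
  \<open>n powr (-1/2)\<close> of the central weights.\<close>

theorem local_limit:
  assumes n: "n \<ge> 2"
  shows "\<bar>binomial_weight n j - gaussian_weight n j\<bar> \<le> 24 / (real n * sqrt (real n))"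
proof -
  let ?h = "\<lambda>u. (indicator {-(pi/2)..pi/2} u * cos u ^ n - exp (- (real n * u\<^sup>2 / 2))) * cos (real_of_int (int n - 2 * j) * u)"
  let ?k = "\<lambda>u. real n * u ^ 4 * exp (- (real n * u\<^sup>2 / 4))"
  have n0: "n > 0" using n by simp
  have "has_bochner_integral lborel ?h (pi * binomial_weight n j - pi * gaussian_weight n j)"
    using has_bochner_integral_diff[OF binomial_weight_has_integral[of n j] gaussian_weight_has_integral[OF n0, of j]]
    by (simp add: algebra_simps)
  then have h: "integrable lborel ?h" "integral\<^sup>L lborel ?h = pi * (binomial_weight n j - gaussian_weight n j)"
    by (auto simp: has_bochner_integral_iff algebra_simps)
  have "\<bar>?h u\<bar> \<le> ?k u" for u
  proof -
    have "\<bar>?h u\<bar> \<le> \<bar>indicator {-(pi/2)..pi/2} u * cos u ^ n - exp (- (real n * u\<^sup>2 / 2))\<bar> * 1"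
      unfolding abs_mult by (intro mult_left_mono abs_cos_le_one) auto
    also have "\<dots> \<le> ?k u" using cos_power_approx[OF n, of u] by simp
    finally show ?thesis .
  qed
  then have "\<bar>integral\<^sup>L lborel ?h\<bar> \<le> integral\<^sup>L lborel ?k"
    using gaussian_fourth_moment[OF n0] h(1)
    by (intro integral_abs_bound[THEN order_trans] integral_mono integrable_abs) (auto simp: has_bochner_integral_iff)
  also have "integral\<^sup>L lborel ?k = 24 * sqrt pi / (real n * sqrt (real n))"
    by (rule has_bochner_integral_integral_eq[OF gaussian_fourth_moment[OF n0]])
  also have "\<dots> \<le> 24 * pi / (real n * sqrt (real n))"
  proof -
    have "sqrt pi \<le> pi" using pi_gt3 by (intro real_le_lsqrt) (auto simp: power2_eq_square)
    then show ?thesis by (intro divide_right_mono) auto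
  qed
  finally have "pi * \<bar>binomial_weight n j - gaussian_weight n j\<bar> \<le> pi * (24 / (real n * sqrt (real n)))"
    unfolding h(2) by (simp add: abs_mult mult_ac)
  then show ?thesis by (rule mult_left_le_imp_le) simp
qed


section \<open>Tail bounds and the l1 distance\<close>

text \<open>Chernoff's argument: one term of the binomial expansion of
  \<open>(exp t + exp (- t)) ^ n\<close> is at most the whole sum
  \<open>(2 * cosh t) ^ n\<close>.\<close>

lemma binomial_weight_le_exp:
  assumes "n > 0"
  shows "binomial_weight n j \<le> exp (- ((2 * real_of_int j - real n)\<^sup>2 / (2 * real n)))"
proof (cases "0 \<le> j \<and> j \<le> int n")
  case False
  then show ?thesis by (simp add: binomial_weight_eq_0 not_le)
next
  case True
  then have k: "j = int (nat j)" "nat j \<le> n" by auto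
  define k where "k = nat j"
  note k = k[folded k_def]
  \<comment> \<open>This \<open>t\<close> minimises the final exponent
    \<open>n * t^2 / 2 - t * (2 * k - n)\<close>.\<close>
  define t where "t = (2 * real k - real n) / real n"
  have tn: "t * real n = 2 * real k - real n" using assms by (simp add: t_def)
  define f where "f i = real (n choose i) * exp t ^ i * exp (- t) ^ (n - i)" for i
  have "f k \<le> sum f {..n}"
    using k by (intro member_le_sum) (auto simp: f_def)
  also have "sum f {..n} = (exp t + exp (- t)) ^ n"
    unfolding f_def by (rule binomial_ring[symmetric])
  finally have "f k \<le> (exp t + exp (- t)) ^ n" .
  moreover have "exp t + exp (- t) = 2 * cosh t"
    by (simp add: cosh_def)
  ultimately have "f k \<le> (2 * cosh t) ^ n" by simp
  also have "\<dots> \<le> (2 * exp (t\<^sup>2 / 2)) ^ n"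
    using cosh_le_exp[of t] by (intro power_mono) auto
  also have "\<dots> = 2 ^ n * exp (real n * (t\<^sup>2 / 2))"
    by (simp only: power_mult_distrib exp_of_nat_mult)
  finally have "real (n choose k) * (exp t ^ k * exp (- t) ^ (n - k)) \<le> 2 ^ n * exp (real n * (t\<^sup>2 / 2))"
    by (simp add: f_def mult_ac)
  moreover have "exp t ^ k * exp (- t) ^ (n - k) = exp (t * (2 * real k - real n))"
  proof -
    have "exp t ^ k * exp (- t) ^ (n - k) = exp (real k * t + real (n - k) * (- t))"
      by (simp only: exp_add exp_of_nat_mult)
    also have "real k * t + real (n - k) * (- t) = t * (2 * real k - real n)"
      using k by (simp add: of_nat_diff algebra_simps)
    finally show ?thesis .
  qed
  ultimately have "real (n choose k) / 2 ^ n * exp (t * (2 * real k - real n)) \<le> exp (real n * (t\<^sup>2 / 2))"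
    by (simp add: field_simps)
  then have "real (n choose k) / 2 ^ n \<le> exp (real n * (t\<^sup>2 / 2)) / exp (t * (2 * real k - real n))"
    by (simp add: pos_le_divide_eq)
  also have "\<dots> = exp (real n * (t\<^sup>2 / 2) - t * (2 * real k - real n))"
    by (simp add: exp_diff)
  also have "real n * (t\<^sup>2 / 2) - t * (2 * real k - real n) = - ((2 * real k - real n)\<^sup>2 / (2 * real n))"
    using assms unfolding tn[symmetric] by (simp add: power2_eq_square)
  finally show ?thesis unfolding k(1) by (simp add: binomial_weight_def)
qed

lemma gaussian_weight_nonneg: "gaussian_weight n j \<ge> 0"
  by (simp add: gaussian_weight_def)

lemma gaussian_weight_le_exp:
  assumes "n > 0"
  shows "gaussian_weight n j \<le> exp (- ((2 * real_of_int j - real n)\<^sup>2 / (2 * real n)))"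
proof -
  have "3 * 1 \<le> pi * real n" using assms pi_gt3 by (intro mult_mono) auto
  then have "sqrt (2 / (pi * real n)) \<le> 1" by simp
  then show ?thesis
    unfolding gaussian_weight_def by (intro mult_left_le_one_le) auto
qed

text \<open>Consecutive values of \<open>2 * j\<close> differ by 2, hence \<open>A + 1\<close> and
  not \<open>2 * A + 1\<close>.\<close>

lemma card_int_ball_le:
  fixes n :: nat and A :: real
  assumes "A \<ge> 0"
  shows "finite {j::int. \<bar>2 * real_of_int j - real n\<bar> \<le> A}"
    and "real (card {j::int. \<bar>2 * real_of_int j - real n\<bar> \<le> A}) \<le> A + 1"
proof -
  let ?lo = "\<lceil>(real n - A) / 2\<rceil>" and ?hi = "\<lfloor>(real n + A) / 2\<rfloor>"
  have sub: "{j::int. \<bar>2 * real_of_int j - real n\<bar> \<le> A} = {?lo..?hi}"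
    by (auto simp: ceiling_le_iff le_floor_iff abs_le_iff field_simps)
  then show "finite {j::int. \<bar>2 * real_of_int j - real n\<bar> \<le> A}" by simp
  show "real (card {j::int. \<bar>2 * real_of_int j - real n\<bar> \<le> A}) \<le> A + 1"
  proof -
    have "2 * real_of_int ?hi \<le> real n + A" "real n - A \<le> 2 * real_of_int ?lo"
      using of_int_floor_le[of "(real n + A) / 2"] le_of_int_ceiling[of "(real n - A) / 2"]
      by (simp_all only: le_divide_eq_numeral1 divide_le_eq_numeral1 mult.commute)
    then have "real_of_int (?hi + 1 - ?lo) \<le> A + 1" by simp
    then show ?thesis
      unfolding sub card_atLeastAtMost_int using assms by (cases "?hi + 1 - ?lo \<ge> 0") (auto simp: of_nat_nat)
  qed
qed

text \<open>Inside a window of width of order \<open>sqrt (n * ln n)\<close> the uniform local limit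
  is summed; outside, both weights are tiny. The constant is \<open>96 + 2\<close>: 24 on at most
  \<open>2 * A\<close> points with \<open>A = 2 * sqrt (n * ln n)\<close>, and 2 from the
  tails.\<close>

theorem local_limit_l1:
  assumes n: "n \<ge> 3"
  shows "(\<Sum>j=0..int n. \<bar>binomial_weight n j - gaussian_weight n j\<bar>) \<le> 98 * sqrt (ln (real n)) / real n"
proof -
  have ln1: "ln (real n) \<ge> 1"
  proof -
    have "exp 1 \<le> real n" using exp_le n by linarith
    then show ?thesis using n by (simp add: ln_ge_iff)
  qed
  \<comment> \<open>With this choice \<open>A^2 / (2 * n) = 2 * ln n\<close>, so both weights are at
    most \<open>1 / n^2\<close> outside the window.\<close>
  define A where "A = 2 * sqrt (real n * ln (real n))"
  have "1 * 1 \<le> real n * ln (real n)" using n ln1 by (intro mult_mono) auto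
  then have "sqrt (real n * ln (real n)) \<ge> 1" by simp
  then have "A \<ge> 1" unfolding A_def by linarith
  moreover have "A\<^sup>2 = 4 * (real n * ln (real n))"
    using n ln1 by (simp add: A_def power_mult_distrib)
  ultimately have A: "A \<ge> 1" "A\<^sup>2 = 4 * (real n * ln (real n))" .
  define J where "J = {j::int. \<bar>2 * real_of_int j - real n\<bar> \<le> A}"
  define e where "e j = \<bar>binomial_weight n j - gaussian_weight n j\<bar>" for j
  have J: "finite J" "real (card J) \<le> A + 1"
    using card_int_ball_le[of A n] A unfolding J_def by auto
  have "sum e J \<le> (\<Sum>j\<in>J. 24 / (real n * sqrt (real n)))"
    using n by (intro sum_mono) (auto simp: e_def intro!: local_limit)
  also have "\<dots> = real (card J) * (24 / (real n * sqrt (real n)))" by simp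
  also have "\<dots> \<le> (2 * A) * (24 / (real n * sqrt (real n)))"
    using J A by (intro mult_right_mono) auto
  also have "\<dots> = 96 * sqrt (ln (real n)) / real n"
    using n by (simp add: A_def real_sqrt_mult)
  finally have 1: "sum e J \<le> 96 * sqrt (ln (real n)) / real n" .
  have tail: "e j \<le> 1 / (real n)\<^sup>2" if "j \<notin> J" for j
  proof -
    have "A\<^sup>2 \<le> (2 * real_of_int j - real n)\<^sup>2"
      using that A(1) unfolding J_def by (auto simp flip: abs_le_square_iff)
    then have "2 * ln (real n) \<le> (2 * real_of_int j - real n)\<^sup>2 / (2 * real n)"
      using n by (simp add: A field_simps)
    then have "exp (- ((2 * real_of_int j - real n)\<^sup>2 / (2 * real n))) \<le> exp (- (2 * ln (real n)))"
      by simp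
    also have "\<dots> = 1 / (real n)\<^sup>2"
      using n exp_of_nat_mult[of 2 "ln (real n)"] by (simp add: exp_minus field_simps)
    finally show ?thesis
      using binomial_weight_le_exp[of n j] gaussian_weight_le_exp[of n j]
        binomial_weight_nonneg[of n j] gaussian_weight_nonneg[of n j] n
      unfolding e_def by linarith
  qed
  have "sum e ({0..int n} - J) \<le> (\<Sum>j\<in>{0..int n} - J. 1 / (real n)\<^sup>2)"
    by (intro sum_mono tail) auto
  also have "\<dots> \<le> (\<Sum>j\<in>{0..int n}. 1 / (real n)\<^sup>2)"
    by (intro sum_mono2) auto
  also have "\<dots> = (real n + 1) / (real n)\<^sup>2" by simp
  also have "\<dots> \<le> (2 * real n) / (real n)\<^sup>2" using n by (intro divide_right_mono) auto
  also have "\<dots> = 2 * 1 / real n" by (simp add: power2_eq_square)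
  also have "\<dots> \<le> 2 * sqrt (ln (real n)) / real n"
    using ln1 by (intro divide_right_mono mult_left_mono) auto
  finally have 2: "sum e ({0..int n} - J) \<le> 2 * sqrt (ln (real n)) / real n" .
  have "sum e {0..int n} = sum e ({0..int n} \<inter> J) + sum e ({0..int n} - J)"
    by (rule sum.Int_Diff) auto
  moreover have "sum e ({0..int n} \<inter> J) \<le> sum e J"
    using J by (intro sum_mono2) (auto simp: e_def)
  ultimately have "sum e {0..int n} \<le> 96 * sqrt (ln (real n)) / real n + 2 * sqrt (ln (real n)) / real n"
    using 1 2 by linarith
  also have "\<dots> = 98 * sqrt (ln (real n)) / real n"
    by (simp flip: add_divide_distrib)
  finally show ?thesis unfolding e_def .
qed

section \<open>The theta transformation formula\<close>

text \<open>Unordered sums are Bochner integrals for the counting measure on \<open>A\<close>, for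
  which every function is measurable and null sets are empty.\<close>

lemma infsum_dominated_convergence:
  fixes F :: "nat \<Rightarrow> 'a \<Rightarrow> 'b::{banach, second_countable_topology}"
  assumes h: "h summable_on A"
    and bound: "\<And>t x. x \<in> A \<Longrightarrow> norm (F t x) \<le> h x"
    and lim: "\<And>x. x \<in> A \<Longrightarrow> (\<lambda>t. F t x) \<longlonglongrightarrow> f x"
  shows "(\<lambda>t. infsum (F t) A) \<longlonglongrightarrow> infsum f A"
proof -
  let ?M = "count_space A"
  have "(\<lambda>x. norm (h x)) summable_on A"
    using h by (rule iffD1[OF summable_on_iff_abs_summable_on_real])
  then have w: "integrable ?M h"
    by (simp only: abs_summable_equivalent Infinite_Set_Sum.abs_summable_on_def)
  have meas: "f \<in> borel_measurable ?M" "\<And>t. F t \<in> borel_measurable ?M" by auto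
  have AE: "AE x in ?M. (\<lambda>t. F t x) \<longlonglongrightarrow> f x" "\<And>t. AE x in ?M. norm (F t x) \<le> h x"
    using bound lim by (auto simp: AE_count_space)
  note dc = meas w AE
  have *: "integral\<^sup>L ?M g = infsum g A" if "integrable ?M g" for g :: "'a \<Rightarrow> 'b"
    using infsetsum_infsum[of g A] that
    by (simp add: Infinite_Set_Sum.abs_summable_on_def infsetsum_def)
  have "integral\<^sup>L ?M f = infsum f A" "\<And>t. integral\<^sup>L ?M (F t) = infsum (F t) A"
    by (rule *[OF integrable_dominated_convergence[OF dc]],
        rule *[OF integrable_dominated_convergence2[OF dc]])
  then show ?thesis
    using integral_dominated_convergence[OF dc] by simp
qed

lemma summable_exp_minus_abs_int:
  fixes c :: real
  assumes "c > 0"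
  shows "(\<lambda>l::int. exp (- (c * \<bar>real_of_int l\<bar>))) summable_on UNIV"
proof -
  let ?f = "\<lambda>l::int. exp (- (c * \<bar>real_of_int l\<bar>))"
  have "summable (\<lambda>k::nat. exp (- c) ^ k)" using assms by (intro summable_geometric) simp
  moreover have "exp (- c) ^ k = exp (- (c * real k))" for k
    by (simp add: mult.commute flip: exp_of_nat_mult)
  ultimately have geo: "(\<lambda>k::nat. exp (- (c * real k))) summable_on UNIV"
    by (intro summable_nonneg_imp_summable_on) simp_all
  have "?f summable_on range int"
    using geo by (subst summable_on_reindex) (auto simp: inj_on_def o_def)
  moreover have "?f summable_on range (\<lambda>k. - int k)"
    using geo by (subst summable_on_reindex) (auto simp: inj_on_def o_def)
  ultimately have "?f summable_on (range int \<union> range (\<lambda>k. - int k))"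
    by (rule summable_on_union)
  moreover have "x \<in> range int \<union> range (\<lambda>k. - int k)" for x
    by (cases x rule: int_cases2) auto
  then have "range int \<union> range (\<lambda>k. - int k) = UNIV" by blast
  ultimately show ?thesis by simp
qed

text \<open>A quadratic exponent dominates a linear one, so a two-sided geometric series is a
  majorant.\<close>

lemma summable_gaussian_int:
  assumes a: "a > 0"
  shows "(\<lambda>l::int. exp (- (a * (real_of_int l - b)\<^sup>2))) summable_on UNIV"
proof (rule summable_on_comparison_test)
  show "(\<lambda>l::int. exp (1 / (4 * a) + \<bar>b\<bar>) * exp (- (1 * \<bar>real_of_int l\<bar>))) summable_on UNIV"
    by (intro summable_on_cmult_right summable_exp_minus_abs_int) simp
  show "exp (- (a * (real_of_int l - b)\<^sup>2)) \<le> exp (1 / (4 * a) + \<bar>b\<bar>) * exp (- (1 * \<bar>real_of_int l\<bar>))" for l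
  proof -
    define x where "x = \<bar>real_of_int l - b\<bar>"
    \<comment> \<open>Expanding this square gives
      \<open>a * x^2 \<ge> x - 1 / (4 * a)\<close>.\<close>
    have "0 \<le> a * (x - 1 / (2 * a))\<^sup>2" using a by simp
    also have "\<dots> = a * x\<^sup>2 - x + 1 / (4 * a)"
      using a by (simp add: power2_diff power_divide right_diff_distrib distrib_left)
         (simp add: power2_eq_square)
    finally have "x - 1 / (4 * a) \<le> a * x\<^sup>2" by simp
    then have "- (a * x\<^sup>2) \<le> 1 / (4 * a) + \<bar>b\<bar> - \<bar>real_of_int l\<bar>"
      unfolding x_def by linarith
    then show ?thesis by (simp add: x_def flip: exp_add)
  qed
qed auto

lemma gaussian_weight_summable:
  assumes "n > 0" "d > 0"
  shows "(\<lambda>k::int. gaussian_weight n (k * int d)) summable_on UNIV"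
proof -
  have "(\<lambda>k::int. sqrt (2 / (pi * real n)) *
     exp (- (2 * (real d)\<^sup>2 / real n * (real_of_int k - real n / (2 * real d))\<^sup>2))) summable_on UNIV"
    using assms by (intro summable_on_cmult_right summable_gaussian_int) simp
  moreover have "2 * (real d)\<^sup>2 / real n * (x - real n / (2 * real d))\<^sup>2 = (2 * (x * real d) - real n)\<^sup>2 / (2 * real n)" for x
  proof -
    have "2 * (x * real d) - real n = 2 * real d * (x - real n / (2 * real d))"
      using assms by (simp add: right_diff_distrib)
    then show ?thesis by (simp add: power_mult_distrib)
  qed
  ultimately show ?thesis by (simp add: gaussian_weight_def)
qed

section \<open>Fourier expansion of residue class probabilities\<close>

text \<open>Orthogonality of the characters modulo \<open>2 * K\<close>, as a geometric sum. The
  frequencies are centred so that the angles \<open>pi * l / (2 * K)\<close> lie in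
  \<open>[-pi/2, pi/2]\<close>, where \<open>cos_le_exp\<close> applies.\<close>

lemma sum_cis_multiples:
  fixes K :: nat and m :: int
  assumes K: "K > 0"
  shows "(\<Sum>l=-int K..<int K. cis (2 * pi * real_of_int l * real_of_int m / (2 * real K)))
           = (if int (2 * K) dvd m then of_nat (2 * K) else 0)"
proof -
  define x where "x = 2 * pi * real_of_int m / (2 * real K)"
  define w where "w = cis x"
  have bij: "bij_betw (\<lambda>i::nat. int i - int K) {..<2*K} {-int K..<int K}"
    by (rule bij_betwI[of _ _ _ "\<lambda>l. nat (l + int K)"]) auto
  have "(\<Sum>l=-int K..<int K. cis (2 * pi * real_of_int l * real_of_int m / (2 * real K)))
      = (\<Sum>i<2*K. cis (2 * pi * real_of_int (int i - int K) * real_of_int m / (2 * real K)))"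
    by (rule sum.reindex_bij_betw[OF bij, symmetric])
  \<comment> \<open>Shifting the range by \<open>K\<close> costs only the factor
    \<open>cis (- (K * x))\<close>, which equals 1 when \<open>2 * K\<close> divides
    \<open>m\<close>.\<close>
  also have "\<dots> = (\<Sum>i<2*K. cis (- (real K * x)) * w ^ i)"
  proof (rule sum.cong[OF refl])
    fix i
    have "2 * pi * real_of_int (int i - int K) * real_of_int m / (2 * real K) = - (real K * x) + real i * x"
      by (simp add: x_def diff_divide_distrib algebra_simps)
    then show "cis (2 * pi * real_of_int (int i - int K) * real_of_int m / (2 * real K)) = cis (- (real K * x)) * w ^ i"
      by (simp only: w_def Complex.DeMoivre cis_mult)
  qed
  also have "\<dots> = cis (- (real K * x)) * (\<Sum>i<2*K. w ^ i)"
    by (simp add: sum_distrib_left)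
  finally have eq: "(\<Sum>l=-int K..<int K. cis (2 * pi * real_of_int l * real_of_int m / (2 * real K)))
      = cis (- (real K * x)) * (\<Sum>i<2*K. w ^ i)" .
  show ?thesis
  proof (cases "int (2 * K) dvd m")
    case True
    then obtain q where q: "m = int (2 * K) * q" by blast
    have x: "x = 2 * pi * real_of_int q" using K by (simp add: x_def q)
    have "w = 1" by (simp add: w_def x cis_multiple_2pi)
    moreover have "- (real K * x) = 2 * pi * real_of_int (- (int K * q))" by (simp add: x)
    then have "cis (- (real K * x)) = 1"
      by (simp only: cis_multiple_2pi Ints_of_int)
    ultimately show ?thesis unfolding eq using True by simp
  next
    case False
    have "w \<noteq> 1"
    proof
      assume "w = 1"
      then have "cos x = 1" by (simp add: w_def complex_eq_iff)
      then obtain q :: int where "x = real_of_int q * 2 * pi" using cos_one_2pi_int by blast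
      then have "real_of_int m = real_of_int (int (2 * K) * q)"
        using K by (simp add: x_def field_simps)
      then have "m = int (2 * K) * q" by (simp only: of_int_eq_iff)
      then show False using False by simp
    qed
    moreover have "w ^ (2 * K) = 1"
    proof -
      have "real (2 * K) * x = 2 * pi * real_of_int m" using K by (simp add: x_def)
      then show ?thesis
        unfolding w_def Complex.DeMoivre by (simp only: cis_multiple_2pi Ints_of_int)
    qed
    ultimately have "(\<Sum>i<2*K. w ^ i) = 0" by (simp add: geometric_sum)
    then show ?thesis unfolding eq using False by simp
  qed
qed

text \<open>By the binomial theorem the sum is \<open>((cis (2 * x) + 1) / 2) ^ N\<close>;
  extracting \<open>cis x\<close> from the base leaves \<open>cos x\<close>.\<close>

lemma sum_binomial_weight_cis:
  "(\<Sum>j=0..int N. complex_of_real (binomial_weight N j) * cis (2 * x * real_of_int j))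
     = cis (real N * x) * complex_of_real (cos x ^ N)"
proof -
  have bij: "bij_betw int {..N} {0..int N}"
    by (rule bij_betwI[of _ _ _ nat]) auto
  have "(\<Sum>j=0..int N. complex_of_real (binomial_weight N j) * cis (2 * x * real_of_int j))
      = (\<Sum>i\<le>N. complex_of_real (binomial_weight N (int i)) * cis (2 * x * real_of_int (int i)))"
    by (rule sum.reindex_bij_betw[OF bij, symmetric])
  also have "\<dots> = (\<Sum>i\<le>N. of_nat (N choose i) * cis (2 * x) ^ i * 1 ^ (N - i) / 2 ^ N)"
    by (intro sum.cong refl) (simp add: binomial_weight_def Complex.DeMoivre mult_ac)
  also have "\<dots> = ((cis (2 * x) + 1) / 2) ^ N"
    by (simp only: power_divide binomial_ring sum_divide_distrib)
  also have "(cis (2 * x) + 1) / 2 = cis x * complex_of_real (cos x)"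
    by (simp add: complex_eq_iff cos_double_cos sin_double power2_eq_square)
  also have "(cis x * complex_of_real (cos x)) ^ N = cis (real N * x) * complex_of_real (cos x ^ N)"
    by (simp add: power_mult_distrib Complex.DeMoivre)
  finally show ?thesis .
qed

text \<open>The residue class is detected by character sums; after exchanging the sums, each
  frequency contributes one value of the characteristic function.\<close>

lemma binomial_weight_progression:
  fixes K N :: nat and r :: int
  assumes K: "K > 0"
  shows "of_nat (2 * K) * complex_of_real (\<Sum>j | j \<in> {0..int N} \<and> int (2 * K) dvd j - r. binomial_weight N j)
     = (\<Sum>l=-int K..<int K. cis (pi * real_of_int l / (2 * real K) * (real N - 2 * real_of_int r))
          * complex_of_real (cos (pi * real_of_int l / (2 * real K)) ^ N))"
proof -
  let ?b = "\<lambda>j. complex_of_real (binomial_weight N j)"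
  let ?c = "\<lambda>l j. cis (2 * pi * real_of_int l * real_of_int (j - r) / (2 * real K))"
  have "of_nat (2 * K) * complex_of_real (\<Sum>j | j \<in> {0..int N} \<and> int (2 * K) dvd j - r. binomial_weight N j)
      = (\<Sum>j\<in>{0..int N}. if int (2 * K) dvd j - r then of_nat (2 * K) * ?b j else 0)"
    unfolding of_real_sum sum_distrib_left by (rule sum.inter_filter) simp
  also have "\<dots> = (\<Sum>j\<in>{0..int N}. ?b j * (\<Sum>l=-int K..<int K. ?c l j))"
    by (intro sum.cong refl) (simp only: sum_cis_multiples[OF K], simp)
  also have "\<dots> = (\<Sum>l=-int K..<int K. \<Sum>j\<in>{0..int N}. ?b j * ?c l j)"
    unfolding sum_distrib_left by (rule sum.swap)
  also have "\<dots> = (\<Sum>l=-int K..<int K. cis (pi * real_of_int l / (2 * real K) * (real N - 2 * real_of_int r))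
          * complex_of_real (cos (pi * real_of_int l / (2 * real K)) ^ N))"
  proof (rule sum.cong[OF refl])
    fix l
    define x where "x = pi * real_of_int l / (2 * real K)"
    have c: "?c l j = cis (- (2 * x * real_of_int r)) * cis (2 * x * real_of_int j)" for j
    proof -
      have "2 * pi * real_of_int l * real_of_int (j - r) / (2 * real K) = - (2 * x * real_of_int r) + 2 * x * real_of_int j"
        by (simp add: x_def diff_divide_distrib algebra_simps)
      then show ?thesis by (simp only: cis_mult)
    qed
    have "(\<Sum>j\<in>{0..int N}. ?b j * ?c l j)
        = cis (- (2 * x * real_of_int r)) * (\<Sum>j\<in>{0..int N}. ?b j * cis (2 * x * real_of_int j))"
      unfolding c sum_distrib_left by (simp only: mult_ac)
    also have "\<dots> = cis (- (2 * x * real_of_int r)) * cis (real N * x) * complex_of_real (cos x ^ N)"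
      unfolding sum_binomial_weight_cis by (rule mult.assoc[symmetric])
    also have "cis (- (2 * x * real_of_int r)) * cis (real N * x) = cis (x * (real N - 2 * real_of_int r))"
      unfolding cis_mult by (simp add: algebra_simps)
    finally show "(\<Sum>j\<in>{0..int N}. ?b j * ?c l j) = cis (pi * real_of_int l / (2 * real K) * (real N - 2 * real_of_int r))
          * complex_of_real (cos (pi * real_of_int l / (2 * real K)) ^ N)"
      unfolding x_def .
  qed
  finally show ?thesis .
qed

section \<open>Scaling limit and the theta identity\<close>

text \<open>The residue \<open>r\<close> is chosen so that \<open>2 (r + k T d) - T^2 n = T (2 k d - n)\<close>. Below, \<open>T\<close> is
  even, so that the Fourier frequencies modulo \<open>T d\<close> can be taken as \<open>{-K..<K}\<close> with \<open>2 K = T d\<close>.\<close>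

lemma gaussian_weight_scale:
  assumes "T > 0" and "2 * r = int T * (int T - 1) * int n"
  shows "real T * gaussian_weight (T\<^sup>2 * n) (r + k * (int T * int d)) = gaussian_weight n (k * int d)"
proof -
  have "2 * real_of_int r = real T * (real T - 1) * real n"
    using arg_cong[OF assms(2), of real_of_int] by simp
  then have "2 * real_of_int (r + k * (int T * int d)) - real (T\<^sup>2 * n)
      = real T * (2 * real_of_int (k * int d) - real n)"
    by (simp add: algebra_simps power2_eq_square)
  then have "(2 * real_of_int (r + k * (int T * int d)) - real (T\<^sup>2 * n))\<^sup>2 / (2 * real (T\<^sup>2 * n))
      = (2 * real_of_int (k * int d) - real n)\<^sup>2 / (2 * real n)"
    using assms(1) by (simp only: power_mult_distrib) simp
  moreover have "real T * sqrt (2 / (pi * real (T\<^sup>2 * n))) = sqrt (2 / (pi * real n))"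
    using assms(1) by (simp add: real_sqrt_divide real_sqrt_mult)
  ultimately show ?thesis
    unfolding gaussian_weight_def by (simp only: mult.assoc[symmetric])
qed

text \<open>Replacing binomial by Gaussian weights costs \<open>T\<close> times the l1 distance for
  \<open>N = T^2 * n\<close> trials, of order \<open>sqrt (ln T) / T\<close>. By
  \<open>gaussian_weight_scale\<close> the rest is a partial sum of the fixed series over
  \<open>k\<close>, over index sets exhausting the integers.\<close>

lemma tendsto_scaled_progression:
  fixes n d :: nat
  assumes n: "n > 0" and d: "d > 0"
  defines "T \<equiv> \<lambda>t::nat. 2 * Suc t"
  defines "r \<equiv> \<lambda>t::nat. int (Suc t * (2 * Suc t - 1) * n)"
  shows "(\<lambda>t. real (T t) * (\<Sum>j | j \<in> {0..int ((T t)\<^sup>2 * n)} \<and> int (T t * d) dvd j - r t.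
            binomial_weight ((T t)\<^sup>2 * n) j))
         \<longlonglongrightarrow> (\<Sum>\<^sub>\<infinity>k. gaussian_weight n (k * int d))"
proof -
  let ?G = "\<lambda>k::int. gaussian_weight n (k * int d)"
  define N where "N t = (T t)\<^sup>2 * n" for t
  define J where "J t = {j. j \<in> {0..int (N t)} \<and> int (T t * d) dvd j - r t}" for t
  define S where "S t = {k::int. r t + k * (int (T t) * int d) \<in> {0..int (N t)}}" for t
  have T0: "T t > 0" for t by (simp add: T_def)
  have r: "2 * r t = int (T t) * (int (T t) - 1) * int n" for t
    by (simp add: r_def T_def of_nat_diff algebra_simps)
  have bij: "bij_betw (\<lambda>k. r t + k * (int (T t) * int d)) (S t) (J t)" for t
  proof (rule bij_betwI[of _ _ _ "\<lambda>j. (j - r t) div (int (T t) * int d)"])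
    show "(\<lambda>k. r t + k * (int (T t) * int d)) \<in> S t \<rightarrow> J t"
      by (auto simp: S_def J_def)
    show "(\<lambda>j. (j - r t) div (int (T t) * int d)) \<in> J t \<rightarrow> S t"
      by (auto simp: S_def J_def)
  qed (use T0[of t] d in \<open>auto simp: J_def\<close>)
  have S_fin: "finite (S t)" for t
  proof -
    have "finite (J t)" by (rule finite_subset[of _ "{0..int (N t)}"]) (auto simp: J_def)
    then show ?thesis using bij_betw_finite[OF bij[of t]] by simp
  qed
  have scaled: "real (T t) * sum (gaussian_weight (N t)) (J t) = sum ?G (S t)" for t
  proof -
    have "sum (gaussian_weight (N t)) (J t) = (\<Sum>k\<in>S t. gaussian_weight (N t) (r t + k * (int (T t) * int d)))"
      by (rule sum.reindex_bij_betw[OF bij, symmetric])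
    then show ?thesis
      using gaussian_weight_scale[OF T0 r] by (simp only: sum_distrib_left N_def)
  qed
  \<comment> \<open>The index sets need not be nested: it suffices that each finite set of integers
    is eventually contained in \<open>S t\<close>.\<close>
  have "filterlim S (finite_subsets_at_top UNIV) sequentially"
    unfolding filterlim_finite_subsets_at_top
  proof (intro allI impI)
    fix X :: "int set" assume "finite X \<and> X \<subseteq> UNIV"
    then have "finite ((\<lambda>k. nat \<bar>k\<bar>) ` X)" by simp
    then obtain b where b: "\<And>k. k \<in> X \<Longrightarrow> nat \<bar>k\<bar> \<le> b"
      by (meson finite_nat_set_iff_bounded_le imageI)
    have "X \<subseteq> S t" if t: "b * d \<le> t" for t
    proof
      fix k assume "k \<in> X"
      then have "\<bar>k\<bar> * int d \<le> int b * int d" using b by (intro mult_right_mono) force+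
      also have "\<dots> \<le> int t" using t by (simp flip: of_nat_mult)
      finally have kd: "\<bar>k * int d\<bar> \<le> int t" by (simp add: abs_mult)
      define y where "y = k * int d"
      have n1: "(2 * int t + 1) * 1 \<le> (2 * int t + 1) * int n" using n by (intro mult_left_mono) auto
      have y: "\<bar>2 * y\<bar> \<le> (2 * int t + 1) * int n"
        proof -
        have "\<bar>2 * y\<bar> = 2 * \<bar>y\<bar>" by (simp add: abs_mult)
        also have "\<dots> \<le> (2 * int t + 1) * 1" using kd by (simp add: y_def)
        finally show ?thesis using n1 by linarith
      qed
      \<comment> \<open>Both the point and the endpoint \<open>N t\<close> contain the factor
        \<open>Suc t\<close>, so membership follows from
        \<open>\<bar>2 * y\<bar> \<le> (2 * t + 1) * n\<close>.\<close>
      have "r t + k * (int (T t) * int d) = int (Suc t) * ((2 * int t + 1) * int n + 2 * y)"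
        by (simp add: r_def T_def y_def algebra_simps)
      moreover have "0 \<le> int (Suc t) * ((2 * int t + 1) * int n + 2 * y)"
        using y by (intro mult_nonneg_nonneg) auto
      moreover have "int (Suc t) * ((2 * int t + 1) * int n + 2 * y) \<le> int (Suc t) * (4 * int (Suc t) * int n)"
      proof (rule mult_left_mono)
        have "2 * y \<le> (2 * int t + 1) * int n" using y by linarith
        then have "(2 * int t + 1) * int n + 2 * y \<le> (2 * int t + 1) * int n + (2 * int t + 1) * int n" by linarith
        also have "\<dots> \<le> 4 * int (Suc t) * int n" by (simp add: algebra_simps)
        finally show "(2 * int t + 1) * int n + 2 * y \<le> 4 * int (Suc t) * int n" .
      qed simp
      moreover have "int (Suc t) * (4 * int (Suc t) * int n) = int (N t)"
        by (simp add: N_def T_def power2_eq_square algebra_simps)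
      ultimately show "k \<in> S t" by (simp only: S_def mem_Collect_eq atLeastAtMost_iff)
    qed
    then show "\<forall>\<^sub>F t in sequentially. finite (S t) \<and> X \<subseteq> S t \<and> S t \<subseteq> UNIV"
      using S_fin by (auto simp: eventually_sequentially)
  qed
  moreover have "(sum ?G \<longlongrightarrow> infsum ?G UNIV) (finite_subsets_at_top UNIV)"
    using has_sum_infsum[OF gaussian_weight_summable[OF n d]] by (simp add: has_sum_def)
  ultimately have main: "(\<lambda>t. sum ?G (S t)) \<longlonglongrightarrow> infsum ?G UNIV"
    by (rule filterlim_compose[rotated])
  have "(\<lambda>t. real (T t) * sum (binomial_weight (N t)) (J t) - sum ?G (S t)) \<longlonglongrightarrow> 0"
  proof (rule Lim_null_comparison)
    show "\<forall>\<^sub>F t in sequentially. norm (real (T t) * sum (binomial_weight (N t)) (J t) - sum ?G (S t))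
        \<le> real (T t) * (98 * sqrt (ln (real (N t))) / real (N t))"
    proof (intro always_eventually allI)
      fix t
      have "3 \<le> N t"
      proof -
        have "2\<^sup>2 * 1 \<le> (T t)\<^sup>2 * n" using n by (intro mult_mono power_mono) (auto simp: T_def)
        then show ?thesis by (simp add: N_def)
      qed
      have "norm (real (T t) * sum (binomial_weight (N t)) (J t) - sum ?G (S t))
          = real (T t) * \<bar>\<Sum>j\<in>J t. binomial_weight (N t) j - gaussian_weight (N t) j\<bar>"
        unfolding scaled[symmetric] by (simp add: sum_subtractf abs_mult flip: right_diff_distrib)
      also have "\<bar>\<Sum>j\<in>J t. binomial_weight (N t) j - gaussian_weight (N t) j\<bar>
          \<le> (\<Sum>j\<in>J t. \<bar>binomial_weight (N t) j - gaussian_weight (N t) j\<bar>)" by (rule sum_abs)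
      also have "\<dots> \<le> (\<Sum>j\<in>{0..int (N t)}. \<bar>binomial_weight (N t) j - gaussian_weight (N t) j\<bar>)"
        by (intro sum_mono2) (auto simp: J_def)
      also have "\<dots> \<le> 98 * sqrt (ln (real (N t))) / real (N t)"
        by (rule local_limit_l1) fact
      finally show "norm (real (T t) * sum (binomial_weight (N t)) (J t) - sum ?G (S t))
        \<le> real (T t) * (98 * sqrt (ln (real (N t))) / real (N t))" by (simp add: mult_left_mono)
    qed
    have "real n > 0" using n by simp
    then have "(\<lambda>t. (2 * (1 + real t)) * (98 * sqrt (ln ((2 * (1 + real t))\<^sup>2 * real n)) / ((2 * (1 + real t))\<^sup>2 * real n))) \<longlonglongrightarrow> 0"
      by real_asymp
    then show "(\<lambda>t. real (T t) * (98 * sqrt (ln (real (N t))) / real (N t))) \<longlonglongrightarrow> 0"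
      by (simp add: N_def T_def)
  qed
  from tendsto_add[OF this main] show ?thesis
    by (simp add: N_def J_def)
qed

text \<open>For \<open>u = \<theta> / T\<close> and \<open>N = T^2 * n\<close> with
  \<open>T = 2 * Suc t\<close>, the product \<open>N * u^2\<close> is constant while the error
  \<open>N * u^4\<close> is of order \<open>1 / T^2\<close>.\<close>

lemma tendsto_cos_power_gaussian:
  fixes \<theta> :: real
  assumes n: "n > 0"
  shows "(\<lambda>t. cos (\<theta> / (2 * real (Suc t))) ^ ((2 * Suc t)\<^sup>2 * n)) \<longlonglongrightarrow> exp (- (real n * \<theta>\<^sup>2 / 2))"
proof -
  have n': "real n > 0" using n by simp
  have "(\<lambda>t. cos (\<theta> / (2 * real (Suc t))) ^ ((2 * Suc t)\<^sup>2 * n) - exp (- (real n * \<theta>\<^sup>2 / 2))) \<longlonglongrightarrow> 0"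
  proof (rule Lim_null_comparison)
    have lim: "(\<lambda>t. \<theta> / (2 * real (Suc t))) \<longlonglongrightarrow> 0" by real_asymp
    have "\<forall>\<^sub>F t in sequentially. \<bar>\<theta> / (2 * real (Suc t))\<bar> < pi / 2"
      using tendstoD[OF lim, of "pi/2"] by simp
    then show "\<forall>\<^sub>F t in sequentially. norm (cos (\<theta> / (2 * real (Suc t))) ^ ((2 * Suc t)\<^sup>2 * n) - exp (- (real n * \<theta>\<^sup>2 / 2)))
        \<le> real n * \<theta> ^ 4 / (2 * (1 + real t))\<^sup>2"
    proof eventually_elim
      case (elim t)
      define s where "s = 2 * real (Suc t)"
      define u where "u = \<theta> / s"
      have s: "s > 0" by (simp add: s_def)
      have "\<bar>u\<bar> < pi / 2" unfolding u_def s_def by (fact elim)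
      then have "- (pi / 2) \<le> u \<and> u \<le> pi / 2" by linarith
      then have ind: "indicator {-(pi/2)..pi/2} u = (1::real)" by simp
      define N where "N = (2 * Suc t)\<^sup>2 * n"
      have N: "real N = s\<^sup>2 * real n" by (simp add: N_def s_def)
      have "2\<^sup>2 * 1 \<le> N" unfolding N_def using n by (intro mult_mono power_mono) auto
      then have "2 \<le> N" by simp
      from cos_power_approx[OF this, of u]
      have "\<bar>cos u ^ N - exp (- (real N * u\<^sup>2 / 2))\<bar> \<le> real N * u ^ 4 * exp (- (real N * u\<^sup>2 / 4))"
        unfolding ind by simp
      also have "\<dots> \<le> real N * u ^ 4 * 1" by (intro mult_left_mono) auto
      also have "real N * u ^ 4 * 1 = real n * \<theta> ^ 4 / s\<^sup>2"
        using s by (simp add: N u_def field_simps power4_eq_xxxx power2_eq_square)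
      also have "real N * u\<^sup>2 / 2 = real n * \<theta>\<^sup>2 / 2"
        using s by (simp add: N u_def power_divide)
      finally show ?case by (simp add: u_def s_def N_def)
    qed
    show "(\<lambda>t. real n * \<theta> ^ 4 / (2 * (1 + real t))\<^sup>2) \<longlonglongrightarrow> 0" by real_asymp
  qed
  then show ?thesis by (simp add: LIM_zero_iff)
qed

text \<open>Both sides are limits of \<open>d * T t * P t\<close>. The scaled progression gives the
  Gaussian series; the Fourier expansion gives \<open>Theta\<close> term by term, under dominated
  convergence.\<close>

theorem Theta_eq_sum_gaussian_weight:
  assumes n: "n > 0" and d: "d > 0"
  shows "Theta d n = of_real (real d * (\<Sum>\<^sub>\<infinity>k. gaussian_weight n (k * int d)))"
proof -
  define T where "T = (\<lambda>t::nat. 2 * Suc t)"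
  define r where "r = (\<lambda>t::nat. int (Suc t * (2 * Suc t - 1) * n))"
  define K where "K t = Suc t * d" for t
  define N where "N t = (T t)\<^sup>2 * n" for t
  define P where "P t = (\<Sum>j | j \<in> {0..int (N t)} \<and> int (T t * d) dvd j - r t. binomial_weight (N t) j)" for t
  define \<theta> where "\<theta> l = pi * real_of_int l / real d" for l
  define c where "c l = cis (\<theta> l * real n)" for l
  \<comment> \<open>Extension by 0 beyond the frequency window puts all \<open>t\<close> on the same
    index set.\<close>
  define F where "F t l = (if l \<in> {-int (K t)..<int (K t)}
      then c l * complex_of_real (cos (\<theta> l / (2 * real (Suc t))) ^ N t) else 0)" for t l
  define f where "f l = c l * complex_of_real (exp (- (real n * (\<theta> l)\<^sup>2 / 2)))" for l
  have K: "K t > 0" for t using d by (simp add: K_def)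
  have TK: "T t * d = 2 * K t" for t by (simp add: T_def K_def)
  have sumF: "complex_of_real (real d * (real (T t) * P t)) = infsum (F t) UNIV" for t
  proof -
    have "complex_of_real (real d * (real (T t) * P t)) = of_nat (2 * K t) * complex_of_real (P t)"
      by (simp add: K_def T_def algebra_simps)
    also have "\<dots> = (\<Sum>l=-int (K t)..<int (K t). cis (pi * real_of_int l / (2 * real (K t)) * (real (N t) - 2 * real_of_int (r t)))
          * complex_of_real (cos (pi * real_of_int l / (2 * real (K t))) ^ N t))"
      unfolding P_def TK by (rule binomial_weight_progression[OF K])
    also have "\<dots> = sum (F t) {-int (K t)..<int (K t)}"
    proof (rule sum.cong[OF refl])
      fix l assume l: "l \<in> {-int (K t)..<int (K t)}"
      have 1: "pi * real_of_int l / (2 * real (K t)) = \<theta> l / (2 * real (Suc t))"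
        by (simp add: K_def \<theta>_def algebra_simps)
      \<comment> \<open>By the choice of \<open>r\<close>, this difference is
        \<open>T t * n\<close>, so the phase \<open>\<theta> l * n\<close> does not depend on
        \<open>t\<close>.\<close>
      have "real (N t) - 2 * real_of_int (r t) = 2 * real (Suc t) * real n"
        by (simp add: N_def r_def T_def of_nat_diff power2_eq_square algebra_simps)
      then have 2: "\<theta> l / (2 * real (Suc t)) * (real (N t) - 2 * real_of_int (r t)) = \<theta> l * real n"
        by simp
      show "cis (pi * real_of_int l / (2 * real (K t)) * (real (N t) - 2 * real_of_int (r t)))
          * complex_of_real (cos (pi * real_of_int l / (2 * real (K t))) ^ N t) = F t l"
        using l unfolding 1 2 F_def c_def by simp
    qed
    also have "\<dots> = infsum (F t) {-int (K t)..<int (K t)}" by simp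
    also have "\<dots> = infsum (F t) UNIV"
      by (rule infsum_cong_neutral) (auto simp: F_def)
    finally show ?thesis .
  qed
  have "(\<lambda>t. infsum (F t) UNIV) \<longlonglongrightarrow> infsum f UNIV"
  proof (rule infsum_dominated_convergence)
    show "(\<lambda>l. exp (- (real n * pi\<^sup>2 / (2 * (real d)\<^sup>2) * (real_of_int l - 0)\<^sup>2))) summable_on UNIV"
      by (rule summable_gaussian_int) (use n d in simp)
    fix l :: int
    have e: "real n * pi\<^sup>2 / (2 * (real d)\<^sup>2) * (real_of_int l - 0)\<^sup>2 = real n * (\<theta> l)\<^sup>2 / 2"
      by (simp add: \<theta>_def power_mult_distrib power_divide)
    show "norm (F t l) \<le> exp (- (real n * pi\<^sup>2 / (2 * (real d)\<^sup>2) * (real_of_int l - 0)\<^sup>2))" for t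
    proof (cases "l \<in> {-int (K t)..<int (K t)}")
      case True
      \<comment> \<open>Within the window \<open>\<bar>u\<bar> \<le> pi / 2\<close>, so
        \<open>cos_le_exp\<close> applies; since \<open>N t * u^2 = n * (\<theta> l)^2\<close>, the
        resulting bound is independent of \<open>t\<close>.\<close>
      define u where "u = \<theta> l / (2 * real (Suc t))"
      have "\<bar>real_of_int l\<bar> \<le> real (K t)" using True by auto
      then have "\<bar>real_of_int l\<bar> / real (K t) \<le> 1" using K[of t] by simp
      moreover have "u = pi / 2 * (real_of_int l / real (K t))"
        by (simp add: u_def \<theta>_def K_def algebra_simps)
      then have "\<bar>u\<bar> = pi / 2 * (\<bar>real_of_int l\<bar> / real (K t))" by (simp add: abs_mult)
      ultimately have "\<bar>u\<bar> \<le> pi / 2 * 1" by (simp only: mult_left_mono pi_half_ge_zero)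
      then have "\<bar>u\<bar> \<le> pi / 2" by simp
      then have "cos u ^ N t \<le> exp (- (u\<^sup>2 / 2)) ^ N t" "0 \<le> cos u"
        by (auto intro!: power_mono cos_le_exp cos_ge_zero)
      moreover have "exp (- (u\<^sup>2 / 2)) ^ N t = exp (real (N t) * - (u\<^sup>2 / 2))"
        by (simp only: exp_of_nat_mult)
      moreover have "real (N t) * - (u\<^sup>2 / 2) = - (real n * (\<theta> l)\<^sup>2 / 2)"
      proof -
        have "real (N t) * u\<^sup>2 = real n * (\<theta> l)\<^sup>2"
        proof -
          define s where "s = 2 * real (Suc t)"
          have "s \<noteq> 0" "real (N t) = s\<^sup>2 * real n" by (simp_all add: s_def N_def T_def)
          then show ?thesis unfolding u_def s_def[symmetric] by (simp add: power_divide)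
        qed
        then show ?thesis by simp
      qed
      ultimately show ?thesis
        using True unfolding e by (simp add: F_def c_def norm_mult norm_power u_def)
    next
      case False
      then show ?thesis by (auto simp: F_def)
    qed
    have "\<forall>\<^sub>F t in sequentially. F t l = c l * complex_of_real (cos (\<theta> l / (2 * real (Suc t))) ^ N t)"
    proof -
      \<comment> \<open>Each frequency enters the window for good, because
        \<open>K t \<ge> Suc t\<close>.\<close>
      have "l \<in> {-int (K t)..<int (K t)}" if "nat \<bar>l\<bar> \<le> t" for t
      proof -
        have "Suc t * 1 \<le> K t" unfolding K_def using d by (intro mult_left_mono) auto
        then show ?thesis using that by auto
      qed
      then show ?thesis unfolding eventually_sequentially F_def by metis
    qed
    moreover have "(\<lambda>t. c l * complex_of_real (cos (\<theta> l / (2 * real (Suc t))) ^ N t)) \<longlonglongrightarrow> f l"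
      unfolding f_def N_def T_def
      by (intro tendsto_mult tendsto_const tendsto_of_real tendsto_cos_power_gaussian n)
    ultimately show "(\<lambda>t. F t l) \<longlonglongrightarrow> f l"
      by (simp only: tendsto_cong)
  qed
  moreover have "(\<lambda>t. complex_of_real (real d * (real (T t) * P t)))
      \<longlonglongrightarrow> of_real (real d * (\<Sum>\<^sub>\<infinity>k. gaussian_weight n (k * int d)))"
    using tendsto_scaled_progression[OF n d]
    by (intro tendsto_of_real tendsto_mult tendsto_const) (simp add: P_def N_def T_def r_def)
  ultimately have "infsum f UNIV = of_real (real d * (\<Sum>\<^sub>\<infinity>k. gaussian_weight n (k * int d)))"
    unfolding sumF by (rule LIMSEQ_unique)
  moreover have "Theta d n = infsum f UNIV"
    unfolding Theta_def
  proof (rule infsum_cong)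
    fix l :: int
    have "f l = exp (\<i> * complex_of_real (\<theta> l * real n)) * exp (complex_of_real (- (real n * (\<theta> l)\<^sup>2 / 2)))"
      unfolding f_def c_def cis_conv_exp exp_of_real ..
    also have "\<dots> = exp (\<i> * complex_of_real (\<theta> l * real n) + complex_of_real (- (real n * (\<theta> l)\<^sup>2 / 2)))"
      by (simp only: exp_add)
    also have "\<i> * complex_of_real (\<theta> l * real n) + complex_of_real (- (real n * (\<theta> l)\<^sup>2 / 2))
      = \<i> * of_nat n * of_real pi * (of_int l / of_nat d)
          - of_nat n * (of_real pi)\<^sup>2 * (of_int l)\<^sup>2 / (2 * (of_nat d)\<^sup>2)"
      by (simp add: \<theta>_def power_mult_distrib power_divide mult_ac)
    finally show "exp (\<i> * of_nat n * of_real pi * (of_int l / of_nat d)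
          - of_nat n * (of_real pi)\<^sup>2 * (of_int l)\<^sup>2 / (2 * (of_nat d)\<^sup>2)) = f l" ..
  qed
  ultimately show ?thesis by simp
qed

section \<open>The sieve\<close>

text \<open>The sum is the expansion of the product of the factors \<open>1 - 1\<close> over
  \<open>A\<close>.\<close>

lemma sum_alternating_Pow:
  assumes "finite A"
  shows "(\<Sum>X\<in>Pow A. (-1 :: int) ^ card X) = (if A = {} then 1 else 0)"
proof -
  have "(\<Prod>x\<in>A. 1 - (1::int)) = (\<Sum>X\<in>Pow A. (-1) ^ card X * (\<Prod>x\<in>X. 1) * (\<Prod>x\<in>A-X. 1))"
    by (rule prod_diff_conv_sum[OF assms])
  then show ?thesis using assms by (simp add: power_0_left card_eq_0_iff)
qed

lemma squarefree_prod_primes: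
  fixes X :: "nat set"
  assumes "finite X" "\<And>p. p \<in> X \<Longrightarrow> prime p"
  shows "squarefree (\<Prod>X)" and "prime_factors (\<Prod>X) = X"
proof -
  have "squarefree (\<Prod>p\<in>X. p)"
    using assms by (intro squarefree_prod_coprime) (auto intro: primes_coprime squarefree_prime)
  then show "squarefree (\<Prod>X)" by simp
  show "prime_factors (\<Prod>X) = X"
  proof -
    have "\<Prod>X \<noteq> 0" using assms by (metis not_prime_0 prod_zero_iff)
    then have *: "p \<in> prime_factors (\<Prod>X) \<longleftrightarrow> prime p \<and> (\<exists>q\<in>X. p dvd q)" for p
      using assms(1) by (auto simp: prime_factors_dvd prime_dvd_prod_iff)
    show ?thesis
    proof (rule Set.set_eqI)
      show "p \<in> prime_factors (\<Prod>X) \<longleftrightarrow> p \<in> X" for p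
        unfolding * using assms(2) by (metis primes_dvd_imp_eq dvd_refl)
    qed
  qed
qed

lemma prod_primes_dvd:
  fixes X :: "nat set"
  assumes "finite X" "\<And>p. p \<in> X \<Longrightarrow> prime p \<and> p dvd j"
  shows "\<Prod>X dvd j"
  using assms
proof (induction X)
  case (insert p X)
  have "coprime p (\<Prod>X)"
    using insert by (intro prod_coprime_right primes_coprime) auto
  then show ?case using insert by (auto intro: divides_mult)
qed simp

lemma squarefree_eq_prod_prime_factors:
  fixes d :: nat
  assumes "squarefree d"
  shows "\<Prod>(prime_factors d) = d"
proof -
  have d: "d \<noteq> 0" using assms by (auto intro: ccontr)
  have "\<forall>p\<in>prime_factors d. multiplicity p d = 1"
    using assms squarefree_factorial_semiring'[OF d] by blast
  then have "(\<Prod>p\<in>prime_factors d. p ^ multiplicity p d) = (\<Prod>p\<in>prime_factors d. p)"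
    by (intro prod.cong) auto
  then show ?thesis using prod_prime_factors[OF d] by simp
qed

lemma finite_sieve_divisors: "finite (sieve_divisors n)"
  by (rule finite_subset[of _ "{..n}"]) (auto simp: sieve_divisors_def)

text \<open>Legendre's sieve: squarefree sieving divisors of \<open>j\<close> correspond to sets of
  primes \<open>p \<le> sqrt n\<close> dividing \<open>j\<close>, so the sum is alternating over a
  power set. The bound \<open>d \<le> n\<close> holds for all these products since they divide
  \<open>j \<le> n\<close>.\<close>

lemma sum_moebius_sieve_divisors:
  fixes j n :: nat
  assumes j: "1 \<le> j" "j \<le> n"
  shows "(\<Sum>d | d \<in> sieve_divisors n \<and> d dvd j. moebius_mu d)
           = (if \<exists>p. prime p \<and> p dvd j \<and> real p \<le> sqrt (real n) then 0 else 1)"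
proof -
  define P where "P = {p. prime p \<and> p dvd j \<and> real p \<le> sqrt (real n)}"
  have "P \<subseteq> {..j}" using j by (auto simp: P_def dvd_imp_le)
  then have P: "finite P" by (rule finite_subset) simp
  \<comment> \<open>Handles the inserted \<open>1\<close> in \<open>largest_prime_factor\<close>, in
    particular for the empty product.\<close>
  have sq: "1 \<le> sqrt (real n)" using j by simp
  define D where "D = {d \<in> sieve_divisors n. d dvd j \<and> squarefree d}"
  have "(\<Sum>d | d \<in> sieve_divisors n \<and> d dvd j. moebius_mu d) = sum moebius_mu D"
    unfolding D_def using finite_sieve_divisors[of n]
    by (intro sum.mono_neutral_right) (auto simp: moebius_mu_def)
  also have "\<dots> = (\<Sum>d\<in>D. (-1) ^ card (prime_factors d))"
    by (intro sum.cong refl) (auto simp: D_def moebius_mu_def)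
  also have "\<dots> = (\<Sum>X\<in>Pow P. (-1) ^ card X)"
  proof (rule sum.reindex_bij_betw)
    show "bij_betw prime_factors D (Pow P)"
    proof (rule bij_betwI[of _ _ _ "\<lambda>X. \<Prod>X"])
      show "prime_factors \<in> D \<rightarrow> Pow P"
      proof (intro funcsetI PowI subsetI)
        fix d p assume d: "d \<in> D" and p: "p \<in> prime_factors d"
        have "p \<le> largest_prime_factor d"
          unfolding largest_prime_factor_def using p by (intro Max_ge) auto
        then have "real p \<le> real (largest_prime_factor d)" by simp
        also have "\<dots> \<le> sqrt (real n)" using d by (simp add: D_def sieve_divisors_def)
        finally show "p \<in> P"
          using d p by (auto simp: P_def D_def in_prime_factors_iff intro: dvd_trans)
      qed
      show "(\<lambda>X. \<Prod>X) \<in> Pow P \<rightarrow> D"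
      proof (intro funcsetI)
        fix X assume "X \<in> Pow P"
        then have X: "finite X" "\<And>p. p \<in> X \<Longrightarrow> prime p" "X \<subseteq> P"
          using P by (auto simp: P_def intro: finite_subset)
        have pf: "prime_factors (\<Prod>X) = X" and sf: "squarefree (\<Prod>X)"
          using squarefree_prod_primes[OF X(1,2)] by auto
        have dvd: "\<Prod>X dvd j" using X by (intro prod_primes_dvd) (auto simp: P_def)
        then have "1 \<le> \<Prod>X" "\<Prod>X \<le> n"
          using j dvd_imp_le[OF dvd] by (auto intro: Nat.gr0I)
        moreover have "Max (insert 1 X) \<in> insert 1 X" using X by (intro Max_in) auto
        then have "real (largest_prime_factor (\<Prod>X)) \<le> sqrt (real n)"
          unfolding largest_prime_factor_def pf using X(3) sq by (auto simp: P_def)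
        ultimately show "\<Prod>X \<in> D" using dvd sf by (simp add: D_def sieve_divisors_def)
      qed
    qed (use P in \<open>auto simp: D_def squarefree_eq_prod_prime_factors P_def
                     intro!: squarefree_prod_primes dest: finite_subset\<close>)
  qed
  also have "\<dots> = (if P = {} then 1 else 0)" by (rule sum_alternating_Pow[OF P])
  finally show ?thesis by (auto simp: P_def)
qed

text \<open>A composite \<open>j \<le> n\<close> has a factor \<open>c > 1\<close> with
  \<open>c * c \<le> n\<close>, whereas the only prime divisor of a prime \<open>j > sqrt n\<close>
  is too large.\<close>

lemma exists_prime_factor_le_sqrt_iff:
  fixes j n :: nat
  assumes j: "sqrt (real n) < real j" "j \<le> n" "n \<ge> 1"
  shows "(\<exists>p. prime p \<and> p dvd j \<and> real p \<le> sqrt (real n)) \<longleftrightarrow> \<not> prime j"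
proof
  assume "\<exists>p. prime p \<and> p dvd j \<and> real p \<le> sqrt (real n)"
  then show "\<not> prime j" using j by (auto dest: primes_dvd_imp_eq)
next
  assume np: "\<not> prime j"
  have "1 \<le> sqrt (real n)" using j by simp
  then have "1 < real j" using j(1) by linarith
  then have "j > 1" by simp
  then obtain a b where ab: "j = a * b" "1 < a" "1 < b"
    using np
    by (metis prime_nat_iff dvdE Suc_lessI dvd_pos_nat dvd_triv_right mult.right_neutral
        less_trans zero_less_one One_nat_def dvd_triv_left)
  have main: "\<exists>p. prime p \<and> p dvd j \<and> real p \<le> sqrt (real n)" if c: "c dvd j" "1 < c" "c * c \<le> j" for c
  proof -
    obtain p where p: "prime p" "p dvd c" using c prime_factor_nat[of c] by auto
    then have "p \<le> c" using c by (intro dvd_imp_le) auto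
    then have "p * p \<le> c * c" by (intro mult_mono) auto
    then have "p * p \<le> n" using c j by linarith
    then have "real p * real p \<le> real n" by (simp flip: of_nat_mult)
    then have "real p \<le> sqrt (real n)" by (intro real_le_rsqrt) (simp add: power2_eq_square)
    then show ?thesis using p c by (auto intro: dvd_trans)
  qed
  show "\<exists>p. prime p \<and> p dvd j \<and> real p \<le> sqrt (real n)"
  proof (cases "a \<le> b")
    case True
    then show ?thesis using ab by (intro main[of a]) auto
  next
    case False
    then show ?thesis using ab by (intro main[of b]) auto
  qed
qed

section \<open>Distribution of the sum\<close>

context prob_space
begin

text \<open>Induction on \<open>n\<close> by splitting on the last summand, which yields Pascal's
  rule. The variables are cast to reals to use independence of a summand from a sum of real
  variables.\<close>

lemma prob_sum_eq_binomial:
  fixes \<beta> :: "nat \<Rightarrow> 'a \<Rightarrow> nat"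
  assumes indep: "indep_vars (\<lambda>_. count_space UNIV) \<beta> {1..}"
    and p0: "\<And>i. i \<ge> 1 \<Longrightarrow> prob {\<omega> \<in> space M. \<beta> i \<omega> = 0} = 1 / 2"
    and p1: "\<And>i. i \<ge> 1 \<Longrightarrow> prob {\<omega> \<in> space M. \<beta> i \<omega> = 1} = 1 / 2"
  shows "{\<omega> \<in> space M. (\<Sum>k=1..n. \<beta> k \<omega>) = j} \<in> events"
    and "prob {\<omega> \<in> space M. (\<Sum>k=1..n. \<beta> k \<omega>) = j} = real (n choose j) / 2 ^ n"
proof -
  define X where "X i \<omega> = real (\<beta> i \<omega>)" for i \<omega>
  define S where "S n \<omega> = (\<Sum>k\<in>{1..n}. X k \<omega>)" for n \<omega>
  have indep_X: "indep_vars (\<lambda>_. borel) X {1..}"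
    unfolding X_def by (rule indep_vars_compose2[OF indep]) auto
  have X_meas[measurable]: "X i \<in> borel_measurable M" if "i \<ge> 1" for i
    using indep_X that unfolding indep_vars_def by auto
  have S_meas[measurable]: "S n \<in> borel_measurable M" for n
    unfolding S_def by (intro borel_measurable_sum X_meas) auto
  have S_eq: "(\<Sum>k=1..n. \<beta> k \<omega>) = j \<longleftrightarrow> S n \<omega> = real j" for n j \<omega>
    by (simp add: S_def X_def flip: of_nat_sum)
  have X_eq: "\<beta> i \<omega> = b \<longleftrightarrow> X i \<omega> = real b" for i b \<omega>
    by (simp add: X_def)
  show "{\<omega> \<in> space M. (\<Sum>k=1..n. \<beta> k \<omega>) = j} \<in> events"
    unfolding S_eq by measurable
  show "prob {\<omega> \<in> space M. (\<Sum>k=1..n. \<beta> k \<omega>) = j} = real (n choose j) / 2 ^ n"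
    unfolding S_eq
  proof (induction n arbitrary: j)
    case 0
    then show ?case by (cases "j = 0") (auto simp: S_def prob_space)
  next
    case (Suc n)
    have i: "Suc n \<ge> 1" by simp
    have S_Suc: "S (Suc n) \<omega> = S n \<omega> + X (Suc n) \<omega>" for \<omega>
      by (simp add: S_def)
    note [measurable] = X_meas[OF i]
    have "indep_vars (\<lambda>_. borel) X (insert (Suc n) {1..n})"
      by (rule indep_vars_subset[OF indep_X]) auto
    then have iv: "indep_var borel (X (Suc n)) borel (S n)"
      unfolding S_def by (intro indep_vars_sum) auto
    have joint: "prob {\<omega> \<in> space M. X (Suc n) \<omega> = x \<and> S n \<omega> = s}
        = prob {\<omega> \<in> space M. X (Suc n) \<omega> = x} * prob {\<omega> \<in> space M. S n \<omega> = s}" for x s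
      using indep_varD[OF iv, of "{x}" "{s}"]
      by (simp add: vimage_def Int_def conj_commute)
    let ?E = "{\<omega> \<in> space M. S (Suc n) \<omega> = real j}"
    let ?Y = "{\<omega> \<in> space M. X (Suc n) \<omega> = 0 \<and> S n \<omega> = real j}"
    let ?Z = "{\<omega> \<in> space M. X (Suc n) \<omega> = 1 \<and> S n \<omega> = real j - 1}"
    have q0: "prob {\<omega> \<in> space M. X (Suc n) \<omega> = 0} = 1 / 2" and q1: "prob {\<omega> \<in> space M. X (Suc n) \<omega> = 1} = 1 / 2"
      using p0[OF i] p1[OF i] unfolding X_eq by auto
    \<comment> \<open>Only the masses at 0 and 1 are given; as they add up to 1, the last summand
      takes no other value almost surely, and the event splits up to a null set.\<close>
    have "prob ({\<omega> \<in> space M. X (Suc n) \<omega> = 0} \<union> {\<omega> \<in> space M. X (Suc n) \<omega> = 1}) = 1"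
      using q0 q1 by (subst finite_measure_Union) auto
    then have "AE \<omega> in M. \<omega> \<in> {\<omega> \<in> space M. X (Suc n) \<omega> = 0} \<union> {\<omega> \<in> space M. X (Suc n) \<omega> = 1}"
      by (subst AE_in_set_eq_1) auto
    then have "AE \<omega> in M. \<omega> \<in> ?E \<longleftrightarrow> \<omega> \<in> ?Y \<union> ?Z"
      by eventually_elim (auto simp: S_Suc)
    then have "prob ?E = prob (?Y \<union> ?Z)"
      by (rule finite_measure_eq_AE) measurable
    also have "\<dots> = prob ?Y + prob ?Z"
      by (rule finite_measure_Union) auto
    also have "prob ?Y = 1 / 2 * (real (n choose j) / 2 ^ n)"
      unfolding joint q0 Suc.IH ..
    also have "prob ?Z = 1 / 2 * prob {\<omega> \<in> space M. S n \<omega> = real j - 1}"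
      unfolding joint q1 ..
    also have "1 / 2 * (real (n choose j) / 2 ^ n) + 1 / 2 * prob {\<omega> \<in> space M. S n \<omega> = real j - 1}
        = real (Suc n choose j) / 2 ^ Suc n"
    proof (cases j)
      case 0
      have "S n \<omega> \<ge> 0" for \<omega> by (simp add: S_def X_def sum_nonneg)
      then have "S n \<omega> \<noteq> real j - 1" for \<omega> using 0 by (metis diff_0 not_one_le_zero neg_0_le_iff_le of_nat_0)
      then show ?thesis using 0 by simp
    next
      case (Suc k)
      then have "real j - 1 = real k" by simp
      then show ?thesis unfolding \<open>real j - 1 = real k\<close> Suc.IH
        using Suc by (simp add: Suc.IH field_simps)
    qed
    finally show ?case .
  qed
qed

text \<open>The binomial masses on \<open>{..n}\<close> already add up to 1, so the possibly
  infinite set \<open>A\<close> can be cut down to \<open>{..n}\<close> up to a null set.\<close>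

lemma prob_sum_in_eq_binomial:
  fixes \<beta> :: "nat \<Rightarrow> 'a \<Rightarrow> nat"
  assumes indep: "indep_vars (\<lambda>_. count_space UNIV) \<beta> {1..}"
    and p0: "\<And>i. i \<ge> 1 \<Longrightarrow> prob {\<omega> \<in> space M. \<beta> i \<omega> = 0} = 1 / 2"
    and p1: "\<And>i. i \<ge> 1 \<Longrightarrow> prob {\<omega> \<in> space M. \<beta> i \<omega> = 1} = 1 / 2"
  shows "prob {\<omega> \<in> space M. (\<Sum>k=1..n. \<beta> k \<omega>) \<in> A} = (\<Sum>j | j \<le> n \<and> j \<in> A. real (n choose j) / 2 ^ n)"
proof -
  define E where "E j = {\<omega> \<in> space M. (\<Sum>k=1..n. \<beta> k \<omega>) = j}" for j
  have E: "E j \<in> events" "prob (E j) = real (n choose j) / 2 ^ n" for j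
    using prob_sum_eq_binomial[OF assms] unfolding E_def by auto
  have un: "prob (\<Union>j\<in>J. E j) = (\<Sum>j\<in>J. real (n choose j) / 2 ^ n)" if "finite J" for J
    using that E by (subst finite_measure_finite_Union) (auto simp: disjoint_family_on_def E_def)
  have "(\<Sum>j\<le>n. real (n choose j) / 2 ^ n) = 1"
    using choose_row_sum[of n] by (simp flip: sum_divide_distrib of_nat_sum)
  then have "prob (\<Union>j\<in>{..n}. E j) = 1" using un[of "{..n}"] by simp
  then have "AE \<omega> in M. \<omega> \<in> (\<Union>j\<in>{..n}. E j)"
    using E by (subst AE_in_set_eq_1) auto
  then have "AE \<omega> in M. \<omega> \<in> (\<Union>j\<in>A. E j) \<longleftrightarrow> \<omega> \<in> (\<Union>j\<in>{j. j \<le> n \<and> j \<in> A}. E j)"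
    by eventually_elim (auto simp: E_def)
  then have "prob (\<Union>j\<in>A. E j) = prob (\<Union>j\<in>{j. j \<le> n \<and> j \<in> A}. E j)"
    using E by (intro finite_measure_eq_AE sets.countable_UN'') auto
  also have "\<dots> = (\<Sum>j | j \<le> n \<and> j \<in> A. real (n choose j) / 2 ^ n)"
    by (rule un) simp
  also have "(\<Union>j\<in>A. E j) = {\<omega> \<in> space M. (\<Sum>k=1..n. \<beta> k \<omega>) \<in> A}"
    by (auto simp: E_def)
  finally show ?thesis .
qed

end

section \<open>The prime probability\<close>

text \<open>For \<open>n > 0\<close> both main terms equal this real number, by
  \<open>sum_Theta_eq\<close> and \<open>infsum_gaussian_eq\<close>, so a single estimate serves
  both claims.\<close>

definition gaussian_sieve_sum :: "nat \<Rightarrow> real" where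
  "gaussian_sieve_sum n =
     (\<Sum>d\<in>sieve_divisors n. real_of_int (moebius_mu d) * (\<Sum>\<^sub>\<infinity>k. gaussian_weight n (k * int d)))"

lemma sum_Theta_eq:
  assumes "n > 0"
  shows "(\<Sum>d\<in>sieve_divisors n. of_int (moebius_mu d) / of_nat d * Theta d n)
           = complex_of_real (gaussian_sieve_sum n)"
  unfolding gaussian_sieve_sum_def of_real_sum
proof (rule sum.cong[OF refl])
  fix d assume "d \<in> sieve_divisors n"
  then have d: "d > 0" by (simp add: sieve_divisors_def)
  show "of_int (moebius_mu d) / of_nat d * Theta d n
     = complex_of_real (real_of_int (moebius_mu d) * (\<Sum>\<^sub>\<infinity>k. gaussian_weight n (k * int d)))"
    using d by (simp add: Theta_eq_sum_gaussian_weight[OF assms d])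
qed

lemma has_sum_finite_sum:
  fixes f :: "'b \<Rightarrow> 'a \<Rightarrow> 'c :: topological_comm_monoid_add"
  assumes "finite D" "\<And>d. d \<in> D \<Longrightarrow> (f d has_sum s d) A"
  shows "((\<lambda>x. \<Sum>d\<in>D. f d x) has_sum sum s D) A"
  using assms by (induction D rule: finite_induct) (auto intro: has_sum_add)

text \<open>The finite sum over \<open>d\<close> may be exchanged with the series over
  \<open>k\<close> because each inner series converges.\<close>

lemma infsum_gaussian_eq:
  assumes "n > 0"
  shows "sqrt (2 / (pi * real n)) *
           (\<Sum>\<^sub>\<infinity>k\<in>(UNIV :: int set). \<Sum>d\<in>sieve_divisors n. real_of_int (moebius_mu d)
              * exp (- ((2 * real_of_int k * real d - real n)\<^sup>2 / (2 * real n))))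
         = gaussian_sieve_sum n"
proof -
  have "((\<lambda>k. \<Sum>d\<in>sieve_divisors n. real_of_int (moebius_mu d) * gaussian_weight n (k * int d))
      has_sum gaussian_sieve_sum n) UNIV"
    unfolding gaussian_sieve_sum_def
    by (intro has_sum_finite_sum finite_sieve_divisors has_sum_cmult_right has_sum_infsum gaussian_weight_summable assms)
       (auto simp: sieve_divisors_def)
  then have "gaussian_sieve_sum n = (\<Sum>\<^sub>\<infinity>k. \<Sum>d\<in>sieve_divisors n. real_of_int (moebius_mu d) * gaussian_weight n (k * int d))"
    by (simp add: infsumI)
  also have "\<dots> = (\<Sum>\<^sub>\<infinity>k\<in>(UNIV :: int set). sqrt (2 / (pi * real n)) * (\<Sum>d\<in>sieve_divisors n. real_of_int (moebius_mu d)
              * exp (- ((2 * real_of_int k * real d - real n)\<^sup>2 / (2 * real n)))))"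
    unfolding gaussian_weight_def sum_distrib_left by (simp add: mult_ac)
  finally show ?thesis by (simp add: infsum_cmult_right')
qed

section \<open>Rearrangement into a weighted sum over \<open>{1..n}\<close>\<close>

text \<open>For \<open>m = k * d\<close> outside \<open>{1..n}\<close>, the distance
  \<open>y = \<bar>2 * m - n\<bar>\<close> is at least both \<open>n\<close> and
  \<open>\<bar>k\<bar>\<close>, so
  \<open>y^2 / (2 * n) \<ge> y / 2 \<ge> n / 4 + \<bar>k\<bar> / 4\<close>.\<close>

lemma gaussian_weight_outside_le:
  assumes n: "n > 0" and d: "d > 0" and k: "k * int d \<notin> {1..int n}"
  shows "gaussian_weight n (k * int d) \<le> exp (- (real n / 4)) * exp (- (1 / 4 * \<bar>real_of_int k\<bar>))"
proof -
  define m where "m = k * int d"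
  define y where "y = \<bar>2 * real_of_int m - real n\<bar>"
  have "\<bar>k\<bar> * 1 \<le> \<bar>k\<bar> * int d" using d by (intro mult_left_mono) auto
  then have "\<bar>k\<bar> \<le> \<bar>m\<bar>" by (simp add: m_def abs_mult)
  moreover have "m \<le> 0 \<or> m > int n" using k by (auto simp: m_def)
  then have "int n \<le> \<bar>2 * m - int n\<bar>" "\<bar>m\<bar> \<le> \<bar>2 * m - int n\<bar>" by auto
  ultimately have "real_of_int (int n) \<le> real_of_int \<bar>2 * m - int n\<bar>"
      "real_of_int \<bar>k\<bar> \<le> real_of_int \<bar>2 * m - int n\<bar>"
    by (simp_all only: of_int_le_iff)
  then have y: "real n \<le> y" "\<bar>real_of_int k\<bar> \<le> y" by (simp_all add: y_def)
  have "real n * y \<le> y * y" using y by (intro mult_right_mono) auto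
  then have "y / 2 \<le> y\<^sup>2 / (2 * real n)" using n by (simp add: field_simps power2_eq_square)
  then have "real n / 4 + 1 / 4 * \<bar>real_of_int k\<bar> \<le> y\<^sup>2 / (2 * real n)" using y by linarith
  then have "exp (- (y\<^sup>2 / (2 * real n))) \<le> exp (- (real n / 4)) * exp (- (1 / 4 * \<bar>real_of_int k\<bar>))"
    by (simp flip: exp_add)
  then show ?thesis
    using gaussian_weight_le_exp[OF n, of m] by (simp add: y_def m_def)
qed

text \<open>A constant independent of \<open>n\<close> and \<open>d\<close>, bounding the discarded
  part of each Gaussian series after extraction of \<open>exp (- n / 4)\<close>.\<close>

definition exp_tail :: real where
  "exp_tail = (\<Sum>\<^sub>\<infinity>k\<in>(UNIV :: int set). exp (- (1 / 4 * \<bar>real_of_int k\<bar>)))"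

text \<open>The indices \<open>k\<close> with \<open>k * d\<close> in \<open>{1..n}\<close> give
  exactly the finite sum; all others, including \<open>k = 0\<close>, fall under
  \<open>gaussian_weight_outside_le\<close>.\<close>

lemma infsum_gaussian_weight_approx:
  assumes n: "n > 0" and d: "d > 0"
  shows "\<bar>(\<Sum>\<^sub>\<infinity>k. gaussian_weight n (k * int d)) - (\<Sum>j | j \<in> {1..n} \<and> d dvd j. gaussian_weight n (int j))\<bar>
           \<le> exp (- (real n / 4)) * exp_tail"
proof -
  let ?G = "\<lambda>k. gaussian_weight n (k * int d)"
  let ?h = "\<lambda>k::int. exp (- (real n / 4)) * exp (- (1 / 4 * \<bar>real_of_int k\<bar>))"
  define K where "K = {k. k * int d \<in> {1..int n}}"
  have bij: "bij_betw (\<lambda>j. int (j div d)) {j. j \<in> {1..n} \<and> d dvd j} K"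
  proof (rule bij_betwI[of _ _ _ "\<lambda>k. nat k * d"])
    show "(\<lambda>k. nat k * d) \<in> K \<rightarrow> {j. j \<in> {1..n} \<and> d dvd j}"
    proof
      fix k assume k: "k \<in> K"
      then have "0 < k * int d" "k * int d \<le> int n" by (auto simp: K_def)
      then have "k > 0" using d by (simp add: zero_less_mult_iff)
      then obtain i where "k = int i" "i > 0" using zero_less_imp_eq_int by blast
      then show "nat k * d \<in> {j. j \<in> {1..n} \<and> d dvd j}"
        using k d by (auto simp: K_def simp flip: of_nat_mult)
    qed
    fix k assume "k \<in> K"
    then have "0 < k * int d" by (auto simp: K_def)
    then have "k > 0" using d by (simp add: zero_less_mult_iff)
    then show "int (nat k * d div d) = k" using d by simp
  qed (auto simp: K_def simp flip: of_nat_mult)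
  have fin: "finite K" using bij_betw_finite[OF bij] by simp
  have "sum ?G K = (\<Sum>j | j \<in> {1..n} \<and> d dvd j. ?G (int (j div d)))"
    by (rule sum.reindex_bij_betw[OF bij, symmetric])
  also have "\<dots> = (\<Sum>j | j \<in> {1..n} \<and> d dvd j. gaussian_weight n (int j))"
    by (intro sum.cong refl) (auto simp flip: of_nat_mult)
  finally have sumK: "sum ?G K = (\<Sum>j | j \<in> {1..n} \<and> d dvd j. gaussian_weight n (int j))" .
  have S: "?G summable_on A" for A
    by (rule summable_on_subset_banach[OF gaussian_weight_summable[OF n d]]) simp
  have H: "?h summable_on A" for A
    by (rule summable_on_subset_banach[OF summable_on_cmult_right[OF summable_exp_minus_abs_int]]) auto
  have "infsum ?G (K \<union> - K) = infsum ?G K + infsum ?G (- K)"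
    by (rule infsum_Un_disjoint) (auto intro: S)
  then have split: "infsum ?G UNIV = sum ?G K + infsum ?G (- K)"
    using fin by simp
  have "infsum ?G (- K) \<le> infsum ?h (- K)"
    using gaussian_weight_outside_le[OF n d] by (intro infsum_mono S H) (auto simp: K_def)
  also have "\<dots> \<le> infsum ?h UNIV"
    by (intro infsum_mono2 H) auto
  also have "\<dots> = exp (- (real n / 4)) * exp_tail"
    unfolding exp_tail_def by (rule infsum_cmult_right')
  finally have "infsum ?G (- K) \<le> exp (- (real n / 4)) * exp_tail" .
  moreover have "0 \<le> infsum ?G (- K)"
    by (rule infsum_nonneg) (rule gaussian_weight_nonneg)
  ultimately show ?thesis using split sumK by simp
qed

lemma abs_moebius_mu_le: "\<bar>real_of_int (moebius_mu d)\<bar> \<le> 1"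
  by (simp add: moebius_mu_def)

text \<open>Exchanging the sums over \<open>d\<close> and \<open>j\<close> produces the sieve weight
  \<open>w j\<close>. Adding the truncation error over up to \<open>n\<close> divisors is harmless
  because it is exponentially small.\<close>

lemma gaussian_sieve_sum_approx:
  assumes n: "n > 0"
  defines "w \<equiv> \<lambda>j. \<Sum>d | d \<in> sieve_divisors n \<and> d dvd j. moebius_mu d"
  shows "\<bar>gaussian_sieve_sum n - (\<Sum>j\<in>{1..n}. gaussian_weight n (int j) * real_of_int (w j))\<bar>
           \<le> real n * (exp (- (real n / 4)) * exp_tail)"
proof -
  let ?s = "\<lambda>d. \<Sum>j | j \<in> {1..n} \<and> d dvd j. gaussian_weight n (int j)"
  have D: "sieve_divisors n \<subseteq> {1..n}" by (auto simp: sieve_divisors_def)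
  have "(\<Sum>d\<in>sieve_divisors n. real_of_int (moebius_mu d) * ?s d)
      = (\<Sum>d\<in>sieve_divisors n. \<Sum>j\<in>{1..n}. if d dvd j then real_of_int (moebius_mu d) * gaussian_weight n (int j) else 0)"
    unfolding sum_distrib_left by (intro sum.cong refl sum.inter_filter) simp
  also have "\<dots> = (\<Sum>j\<in>{1..n}. \<Sum>d\<in>sieve_divisors n. if d dvd j then real_of_int (moebius_mu d) * gaussian_weight n (int j) else 0)"
    by (rule sum.swap)
  also have "\<dots> = (\<Sum>j\<in>{1..n}. gaussian_weight n (int j) * real_of_int (w j))"
    unfolding w_def of_int_sum sum_distrib_left
    by (simp add: sum.inter_filter[OF finite_sieve_divisors] mult.commute)
  finally have eq: "(\<Sum>j\<in>{1..n}. gaussian_weight n (int j) * real_of_int (w j))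
      = (\<Sum>d\<in>sieve_divisors n. real_of_int (moebius_mu d) * ?s d)" ..
  have "gaussian_sieve_sum n - (\<Sum>j\<in>{1..n}. gaussian_weight n (int j) * real_of_int (w j))
      = (\<Sum>d\<in>sieve_divisors n. real_of_int (moebius_mu d) * ((\<Sum>\<^sub>\<infinity>k. gaussian_weight n (k * int d)) - ?s d))"
    unfolding eq gaussian_sieve_sum_def by (simp only: sum_subtractf right_diff_distrib)
  also have "\<bar>\<dots>\<bar> \<le> (\<Sum>d\<in>sieve_divisors n. 1 * (exp (- (real n / 4)) * exp_tail))"
  proof (rule order_trans[OF sum_abs], rule sum_mono)
    fix d assume "d \<in> sieve_divisors n"
    then have "d > 0" using D by auto
    then show "\<bar>real_of_int (moebius_mu d) * ((\<Sum>\<^sub>\<infinity>k. gaussian_weight n (k * int d)) - ?s d)\<bar>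
        \<le> 1 * (exp (- (real n / 4)) * exp_tail)"
      unfolding abs_mult
      by (intro mult_mono abs_moebius_mu_le infsum_gaussian_weight_approx n) auto
  qed
  also have "\<dots> = real (card (sieve_divisors n)) * (exp (- (real n / 4)) * exp_tail)" by simp
  also have "\<dots> \<le> real n * (exp (- (real n / 4)) * exp_tail)"
  proof (rule mult_right_mono)
    show "real (card (sieve_divisors n)) \<le> real n" using card_mono[OF _ D] by simp
    show "0 \<le> exp (- (real n / 4)) * exp_tail"
      unfolding exp_tail_def by (intro mult_nonneg_nonneg infsum_nonneg) auto
  qed
  finally show ?thesis .
qed

section \<open>Comparison with the prime probability\<close>

lemma prime_probability_approx:
  assumes n: "n \<ge> 16"
  shows "\<bar>(\<Sum>j | j \<le> n \<and> prime j. real (n choose j) / 2 ^ n) - gaussian_sieve_sum n\<bar>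
     \<le> 98 * sqrt (ln (real n)) / real n + real n * exp (- (real n / 8)) + exp_tail * (real n * exp (- (real n / 4)))"
proof -
  let ?b = "\<lambda>j. binomial_weight n (int j)" and ?g = "\<lambda>j. gaussian_weight n (int j)"
  define w where "w j = (\<Sum>d | d \<in> sieve_divisors n \<and> d dvd j. moebius_mu d)" for j
  define W where "W j = real_of_int (w j)" for j
  define p where "p j = (if prime j then 1 else 0 :: real)" for j :: nat
  have n0: "n > 0" using n by simp
  have W: "W j = (if \<exists>p. prime p \<and> p dvd j \<and> real p \<le> sqrt (real n) then 0 else 1)" if "j \<in> {1..n}" for j
    using that unfolding W_def w_def by (subst sum_moebius_sieve_divisors) auto
  \<comment> \<open>This is where 16 comes from; it keeps every \<open>j \<le> sqrt n\<close> at
    distance at least \<open>n / 4\<close> from the mean \<open>n / 2\<close>.\<close>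
  have sqrt_le: "sqrt (real n) \<le> real n / 4"
    using n mult_right_mono[of 16 "real n" "real n"] by (intro real_le_lsqrt) (auto simp: power2_eq_square)
  have "(\<Sum>j | j \<le> n \<and> prime j. real (n choose j) / 2 ^ n) = (\<Sum>j | j \<in> {1..n} \<and> prime j. ?b j)"
    by (intro sum.cong) (auto simp: binomial_weight_def Suc_le_eq prime_gt_0_nat)
  also have "\<dots> = (\<Sum>j\<in>{1..n}. ?b j * p j)"
    by (subst sum.inter_filter) (auto simp: p_def intro: sum.cong)
  finally have P: "(\<Sum>j | j \<le> n \<and> prime j. real (n choose j) / 2 ^ n) = (\<Sum>j\<in>{1..n}. ?b j * p j)" .
  have "\<bar>\<Sum>j\<in>{1..n}. (?b j - ?g j) * W j\<bar> \<le> (\<Sum>j\<in>{1..n}. \<bar>?b j - ?g j\<bar>)"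
    by (intro sum_abs[THEN order_trans] sum_mono) (auto simp: W abs_mult)
  also have "\<dots> \<le> (\<Sum>j\<in>{..n}. \<bar>?b j - ?g j\<bar>)" by (intro sum_mono2) auto
  also have "\<dots> = (\<Sum>j=0..int n. \<bar>binomial_weight n j - gaussian_weight n j\<bar>)"
    by (rule sum.reindex_bij_betw, rule bij_betwI[of _ _ _ nat]) auto
  also have "\<dots> \<le> 98 * sqrt (ln (real n)) / real n"
    using n by (intro local_limit_l1) simp
  finally have 1: "\<bar>\<Sum>j\<in>{1..n}. (?b j - ?g j) * W j\<bar> \<le> 98 * sqrt (ln (real n)) / real n" .
  have "\<bar>?b j * (p j - W j)\<bar> \<le> exp (- (real n / 8))" if j: "j \<in> {1..n}" for j
  proof (cases "sqrt (real n) < real j")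
    case True
    then have "p j = W j"
      using j exists_prime_factor_le_sqrt_iff[of n j] n by (simp add: W p_def)
    then show ?thesis by simp
  next
    case False
    \<comment> \<open>Here \<open>W j\<close> can differ from the prime indicator: small primes are
      sieved out and \<open>j = 1\<close> survives. Smallness must come from the binomial weight
      instead.\<close>
    then have "real n / 2 \<le> real n - 2 * real j" using sqrt_le by linarith
    then have "(real n / 2)\<^sup>2 \<le> (real n - 2 * real j)\<^sup>2" by (intro power_mono) auto
    then have "real n / 8 \<le> (real n - 2 * real j)\<^sup>2 / (2 * real n)"
      using n0 by (simp add: field_simps power2_eq_square)
    then have *: "exp (- ((2 * real j - real n)\<^sup>2 / (2 * real n))) \<le> exp (- (real n / 8))"
      by (simp add: power2_commute)
    have "?b j \<le> exp (- ((2 * real j - real n)\<^sup>2 / (2 * real n)))"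
      using binomial_weight_le_exp[OF n0, of "int j"] by simp
    also note *
    finally have "?b j \<le> exp (- (real n / 8))" .
    moreover have "\<bar>p j - W j\<bar> \<le> 1" using j by (auto simp: p_def W)
    ultimately have "?b j * \<bar>p j - W j\<bar> \<le> exp (- (real n / 8)) * 1"
      by (intro mult_mono) auto
    then show ?thesis by (simp add: abs_mult binomial_weight_nonneg)
  qed
  then have "(\<Sum>j\<in>{1..n}. \<bar>?b j * (p j - W j)\<bar>) \<le> (\<Sum>j\<in>{1..n}. exp (- (real n / 8)))"
    by (intro sum_mono)
  then have 2: "\<bar>\<Sum>j\<in>{1..n}. ?b j * (p j - W j)\<bar> \<le> real n * exp (- (real n / 8))"
    by (intro order_trans[OF sum_abs]) simp
  have 3: "\<bar>gaussian_sieve_sum n - (\<Sum>j\<in>{1..n}. ?g j * W j)\<bar> \<le> exp_tail * (real n * exp (- (real n / 4)))"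
    using gaussian_sieve_sum_approx[OF n0] unfolding W_def w_def by (simp only: mult_ac)
  \<comment> \<open>Binomial weights are exchanged for Gaussian ones only under the factor
    \<open>W\<close>, so the three sums are exactly those bounded above.\<close>
  have "(\<Sum>j\<in>{1..n}. ?b j * p j)
      = (\<Sum>j\<in>{1..n}. (?b j - ?g j) * W j) + (\<Sum>j\<in>{1..n}. ?b j * (p j - W j)) + (\<Sum>j\<in>{1..n}. ?g j * W j)"
    by (simp add: algebra_simps flip: sum.distrib)
  then show ?thesis unfolding P using 1 2 3 by linarith
qed

theorem theorem3p22:
  fixes M :: "'a measure" and \<beta> :: "nat \<Rightarrow> 'a \<Rightarrow> nat" and B :: "nat \<Rightarrow> 'a \<Rightarrow> nat"
  assumes "prob_space M"
    and "prob_space.indep_vars M (\<lambda>_. count_space UNIV) \<beta> {1..}"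
    and "\<And>i. i \<ge> 1 \<Longrightarrow> measure M {\<omega> \<in> space M. \<beta> i \<omega> = 0} = 1 / 2"
    and "\<And>i. i \<ge> 1 \<Longrightarrow> measure M {\<omega> \<in> space M. \<beta> i \<omega> = 1} = 1 / 2"
    and "\<And>n \<omega>. B n \<omega> = (\<Sum>k=1..n. \<beta> k \<omega>)"
  shows "(\<lambda>n. cmod (complex_of_real (measure M {\<omega> \<in> space M. prime (B n \<omega>)})
                 - (\<Sum>d\<in>sieve_divisors n. of_int (moebius_mu d) / of_nat d * Theta d n)))
           \<in> O(\<lambda>n. ln (real n) powr (5 / 2) / real n)
       \<and> (\<lambda>n. measure M {\<omega> \<in> space M. prime (B n \<omega>)}
             - sqrt (2 / (pi * real n)) *
               (\<Sum>\<^sub>\<infinity>k\<in>(UNIV :: int set). \<Sum>d\<in>sieve_divisors n.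
                  real_of_int (moebius_mu d)
                  * exp (- ((2 * real_of_int k * real d - real n)\<^sup>2 / (2 * real n)))))
           \<in> O(\<lambda>n. ln (real n) powr (5 / 2) / real n)"
proof -
  let ?P = "\<lambda>n. measure M {\<omega> \<in> space M. prime (B n \<omega>)}"
  let ?g = "\<lambda>n. ln (real n) powr (5 / 2) / real n"
  interpret prob_space M by fact
  have P: "?P n = (\<Sum>j | j \<le> n \<and> prime j. real (n choose j) / 2 ^ n)" for n
    using prob_sum_in_eq_binomial[OF assms(2-4), of n "Collect prime"] by (simp add: assms(5))
  have tail: "(\<lambda>n. exp_tail * (real n * exp (- (real n / 4)))) \<in> O(?g)"
  proof -
    have "(\<lambda>n. real n * exp (- (real n / 4))) \<in> O(?g)" by real_asymp
    then show ?thesis by (cases "exp_tail = 0") auto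
  qed
  have "(\<lambda>n. ?P n - gaussian_sieve_sum n) \<in> O(\<lambda>n. 98 * sqrt (ln (real n)) / real n
      + real n * exp (- (real n / 8)) + exp_tail * (real n * exp (- (real n / 4))))"
  proof (rule landau_o.big_mono)
    show "\<forall>\<^sub>F n in sequentially. norm (?P n - gaussian_sieve_sum n) \<le> norm (98 * sqrt (ln (real n)) / real n
      + real n * exp (- (real n / 8)) + exp_tail * (real n * exp (- (real n / 4))))"
      using eventually_ge_at_top[of 16]
    proof eventually_elim
      case (elim n)
      then show ?case using prime_probability_approx[OF elim] unfolding P by simp
    qed
  qed
  \<comment> \<open>The first term, of order \<open>sqrt (ln n) / n\<close>, dominates the two
    exponentially small ones and lies within the claimed order.\<close>
  also have "(\<lambda>n. 98 * sqrt (ln (real n)) / real n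
      + real n * exp (- (real n / 8)) + exp_tail * (real n * exp (- (real n / 4)))) \<in> O(?g)"
    by (intro sum_in_bigo tail) real_asymp+
  finally have main: "(\<lambda>n. ?P n - gaussian_sieve_sum n) \<in> O(?g)" .
  \<comment> \<open>Both identities for the main terms require \<open>n > 0\<close>, which suffices
    for statements about large \<open>n\<close>.\<close>
  have pos: "\<forall>\<^sub>F n in sequentially. (n::nat) > 0" by (rule eventually_gt_at_top)
  show ?thesis
  proof
    have "(\<lambda>n. \<bar>?P n - gaussian_sieve_sum n\<bar>) \<in> O(?g)" using main by simp
    moreover have "\<forall>\<^sub>F n in sequentially. cmod (complex_of_real (?P n)
        - (\<Sum>d\<in>sieve_divisors n. of_int (moebius_mu d) / of_nat d * Theta d n)) = \<bar>?P n - gaussian_sieve_sum n\<bar>"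
      using pos by eventually_elim (simp only: sum_Theta_eq norm_of_real flip: of_real_diff)
    ultimately show "(\<lambda>n. cmod (complex_of_real (?P n)
        - (\<Sum>d\<in>sieve_divisors n. of_int (moebius_mu d) / of_nat d * Theta d n))) \<in> O(?g)"
      by (subst landau_o.big.in_cong)
    have "\<forall>\<^sub>F n in sequentially. ?P n - sqrt (2 / (pi * real n)) *
               (\<Sum>\<^sub>\<infinity>k\<in>(UNIV :: int set). \<Sum>d\<in>sieve_divisors n.
                  real_of_int (moebius_mu d)
                  * exp (- ((2 * real_of_int k * real d - real n)\<^sup>2 / (2 * real n)))) = ?P n - gaussian_sieve_sum n"
      using pos by eventually_elim (simp only: infsum_gaussian_eq)
    then show "(\<lambda>n. ?P n - sqrt (2 / (pi * real n)) *
               (\<Sum>\<^sub>\<infinity>k\<in>(UNIV :: int set). \<Sum>d\<in>sieve_divisors n.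
                  real_of_int (moebius_mu d)
                  * exp (- ((2 * real_of_int k * real d - real n)\<^sup>2 / (2 * real n))))) \<in> O(?g)"
      using main by (subst landau_o.big.in_cong)
  qed
qed

end
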